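(* Let $\mathcal N$ be a DPN with initial state $(M_I,\alpha_0)$ and final marking $M_F$, let $\mathbf{ue}=\{ue_1,\dots,ue_m\}$ be a log trace with uncertainty, and let $P_L,P_M,P_=$ be penalty functions as in the context. Assume that $M_F$ is non-empty and that there is a silent transition $t$ such that for every state variable assignment $\alpha$ there is a valid transition firing $(M_F,\alpha)\xrightarrow{(t,\beta)}(M_F,\alpha)$. Let $n$ be a natural number such that there is an alignment $\gamma$ that is optimal for $\mathbf{ue}$ and whose model projection $\gamma|_M$ has length at most $n$. Let $\nu$ be a solution of the constrained optimization problem $$(\Phi)\qquad \varphi_{\mathit{run}}\wedge\varphi_{\mathit{trace}}\wedge\varphi_\delta\quad\text{minimizing } \mathtt d_{m,n},$$ i.e. an assignment satisfying the three formulas for which $\nu(\mathtt d_{m,n})$ is minimal among all satisfying assignments. Then the decoded sequence of moves $\gamma_{m,n}$ is an optimal alignment for $\mathbf{ue}$, and its cost is $\mathfrak K(\gamma_{m,n},\mathbf{ue})=\nu(\mathtt d_{m,n})$.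
   Context: **DPNs.** $V$ is a finite set of process variables, each with a type (bool, int, rat, string) and the corresponding domain; $V^r=\{v^r\mid v\in V\}$, $V^w=\{v^w\mid v\in V\}$ are disjoint sets of read/written copies. Constraints are Boolean combinations of: Boolean variables and constants; comparisons $\ge$ of integer terms; comparisons $\ge,>$ of rational terms; equalities of string terms. Integer/rational terms are built from variables and constants of that type with $+$ and unary $-$; string terms are variables or constants. A DPN is $\mathcal N=(P,T,F,\ell,A,V,guard)$ with $P,T$ finite disjoint non-empty sets of places and transitions, $F:(P\times T)\cup(T\times P)\to\mathbb N$, $\ell:T\to A\cup\{\tau\}$ with $A$ a finite set of activity labels ($t$ is silent if $\ell(t)=\tau$), and $guard$ mapping each $t\in T$ to a constraint over $V^r\cup V^w$, where guards of silent transitions use no variable of $V^w$. Let $write(t)=\{v\mid v^w\text{ occurs in }guard(t)\}$, $|{}^\bullet t|_p=F(p,t)$, $|t^\bullet|_p=F(t,p)$, and ${}^\bullet t=\{p\mid F(p,t)>0\}$. A state variable assignment $\alpha$ gives each $v\in V$ a value of its domain. A state is $(M,\alpha)$ with $M:P\to\mathbb N$. A transition firing is $(t,\beta)$ with $t\in T$ and $\beta$ a type-respecting assignment of $V^r\cup V^w$. It is valid in $(M,\alpha)$ and leads to $(M',\alpha')$, written $(M,\alpha)\xrightarrow{(t,\beta)}(M',\alpha')$, if $M(p)\ge|{}^\bullet t|_p$ and $M'(p)=M(p)-|{}^\bullet t|_p+|t^\bullet|_p$ for all $p$; $\beta(v^r)=\alpha(v)$ and $\beta(v^w)=\alpha'(v)$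 for all $v$; $\beta$ satisfies $guard(t)$; and $\alpha'(v)=\alpha(v)$ for all $v\notin write(t)$. An initial state $(M_I,\alpha_0)$ and a final marking $M_F$ are fixed. A process run is a finite sequence of successively valid firings from $(M_I,\alpha_0)$ to some $(M_F,\alpha_F)$; $Runs(\mathcal N)$ is the set of process runs, assumed non-empty; $\mathcal F(\mathcal N)$ is the set of transition firings. **Traces with uncertainty.** An event with uncertainty is $ue=\langle \mathrm{ID},conf,\mathrm{LA},\mathrm{TS},\alpha\rangle$ with an identifier $\mathrm{ID}$; a confidence $0<conf\le1$; a finite non-empty set $\mathrm{LA}=\{b_1{:}p_1,\dots,b_N{:}p_N\}$ of distinct labels $b_k\in A$ with confidences $0<p_k\le 1$, $\sum_k p_k=1$; $\mathrm{TS}$ a non-empty finite subset of $\mathbb N$ or non-empty closed interval $[l,u]$ of $\mathbb N$; and $\alpha$ a partial function mapping variables $v\in V$ to a non-empty finite set of values of the domain of $v$ or (for types int, rat) a non-empty closed interval $[l,u]$ of it. Components are written $\mathrm{ID}(ue)$, $conf(ue)$, etc. A label $b$ is admissible for $ue$ if $(b,p)\in \mathrm{LA}(ue)$ for some $p$; a timestamp is admissible if it belongs to $\mathrm{TS}(ue)$. A log trace with uncertainty $\mathbf{ue}$ is a finite set of events with uncertainty with pairwise distinct identifiers. An event is $e=(\mathrm{ID},b,\hat\alpha)$ with $b\in A$ (written $lab(e)$) and $\hat\alpha$ assigning to each $v\in V$ one value of its type; $\mathcal E$ is the set of events. A sequence $\langle e_1,\dots,e_k\rangle$ of events is a realization of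 $\mathbf{ue}$ if there are (pairwise distinct) $ue_1,\dots,ue_k\in\mathbf{ue}$ and $t_1\le\dots\le t_k$ such that for all $i$: $t_i$ is admissible for $ue_i$; $\mathrm{ID}(e_i)=\mathrm{ID}(ue_i)$; $lab(e_i)$ is admissible for $ue_i$; $\hat\alpha(e_i)(v)\in\alpha(ue_i)(v)$ whenever the latter is defined; and moreover every $ue\in\mathbf{ue}$ with $conf(ue)=1$ is among $ue_1,\dots,ue_k$. **Alignments and costs.** With a skip symbol $\gg$, a move is a pair $(e,f)\in(\mathcal E\cup\{\gg\})\times(\mathcal F(\mathcal N)\cup\{\gg\})$ other than $(\gg,\gg)$. For a sequence of moves $\gamma$, $\gamma|_L$ and $\gamma|_M$ are the sequences of first, resp. second, components with all $\gg$ deleted. $\gamma$ is a (complete) alignment of a realization $\mathbf e$ if $\gamma|_L=\mathbf e$ and $\gamma|_M\in Runs(\mathcal N)$. Penalty functions are $P_L:\mathcal E\to(0,\infty)$, $P_M:\mathcal F(\mathcal N)\to[0,\infty)$ with $P_M(t,\beta)=0$ for silent $t$, and $P_=:\mathcal E\times\mathcal F(\mathcal N)\to[0,\infty]$ (for instance: $P_L=1$; $P_M(t,\beta)=1+|write(t)|$ for non-silent $t$; $P_=((\mathrm{ID},b,\hat\alpha),(t,\beta))=|\{v\mid\hat\alpha(v)\ne\beta(v^w)\}|/|V|$ if $b=\ell(t)$ and $\infty$ otherwise). For an event $e$ of a realization, with $ue\in\mathbf{ue}$, $\mathrm{ID}(ue)=\mathrm{ID}(e)$, and $(lab(e),p)\in\mathrm{LA}(ue)$,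 put $\theta(e,\mathbf{ue})=(1-conf(ue))+(1-p)$. The cost of a move is: $P_M(f)$ for $(\gg,f)$; $P_L(e)(1+\theta(e,\mathbf{ue}))$ for $(e,\gg)$; and for $(e,f)$ with $e,f\neq\gg$, $\theta(e,\mathbf{ue})$ if $P_=(e,f)=0$ and $P_=(e,f)(1+\theta(e,\mathbf{ue}))$ otherwise. The alignment cost $\kappa_A(\gamma,\mathbf{ue})$ is the sum of the costs of the moves of $\gamma$. The removal cost $\kappa_R(\mathbf e,\mathbf{ue})$ is the sum, over all $ue\in\mathbf{ue}$ whose identifier does not occur in $\mathbf e$, of $conf(ue)$ if $conf(ue)<1$ and $\infty$ otherwise. For an alignment $\gamma$ of $\mathbf e$, $\mathfrak K(\gamma,\mathbf{ue})=\kappa_A(\gamma,\mathbf{ue})+\kappa_R(\mathbf e,\mathbf{ue})$. $\gamma$ is optimal for $\mathbf{ue}$ if it is an alignment of some realization of $\mathbf{ue}$ and no realization $\mathbf e'$ of $\mathbf{ue}$ and alignment $\gamma'$ of $\mathbf e'$ satisfy $\mathfrak K(\gamma',\mathbf{ue})<\mathfrak K(\gamma,\mathbf{ue})$. **Encoding** (for $\mathcal N$, $T=\{t_1,\dots,t_{|T|}\}$, $\mathbf{ue}=\{ue_1,\dots,ue_m\}$, and $n\in\mathbb N$). Variables: integers $\mathtt S_i$ ($1\le i\le n$), $\mathtt M_{i,p}$ ($0\le i\le n$, $p\in P$); $\mathtt X_{i,v}$ of the type of $v$ ($0\le i\le n$, $v\in V$); for each $ue\in\mathbf{ue}$: Boolean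 $\mathtt{drop}_{ue}$, integers $\mathtt A_{ue},\mathtt T_{ue},\mathtt P_{ue}$, and $\mathtt D_{v,ue}$ of the type of $v$; $\mathtt L_j$ ($1\le j\le m$) ranging over identifiers; numeric $\mathtt d_{i,j}$ ($0\le i\le m$, $0\le j\le n$). $\varphi_{\mathit{run}}$ is the conjunction of: - $\mathtt M_{0,p}=M_I(p)$, $\mathtt M_{n,p}=M_F(p)$ for all $p$, and $\mathtt X_{0,v}=\alpha_0(v)$ for all $v$; - $1\le\mathtt S_i\le|T|$ for $1\le i\le n$; - for all $1\le i\le n$, $1\le j\le|T|$: $\mathtt S_i=j$ implies (1) $\mathtt M_{i-1,p}\ge|{}^\bullet t_j|_p$ for all $p\in{}^\bullet t_j$; (2) $\mathtt M_{i,p}-\mathtt M_{i-1,p}=|t_j^\bullet|_p-|{}^\bullet t_j|_p$ for all $p\in P$; (3) $guard(t_j)$ with each $v^r$ replaced by $\mathtt X_{i-1,v}$ and each $v^w$ by $\mathtt X_{i,v}$, and $\mathtt X_{i-1,v}=\mathtt X_{i,v}$ for all $v\notin write(t_j)$. $\varphi_{\mathit{trace}}$ is the conjunction of: for each $ue\in\mathbf{ue}$, $\mathtt{drop}_{ue}\Rightarrow conf(ue)<1$; $1\le\mathtt A_{ue}\le|\mathrm{LA}(ue)|$; $\mathtt D_{v,ue}\in\alpha(ue)(v)$ for all $v$ with $\alpha(ue)(v)$ defined; $\mathtt T_{ue}\in\mathrm{TS}(ue)$; $\mathtt L_j\in\{\mathrm{ID}(ue_1),\dots,\mathrm{ID}(ue_m)\}$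 for $1\le j\le m$; and for all $1\le i,j\le m$: $\mathtt P_{ue_i}<\mathtt P_{ue_j}\Rightarrow\mathtt T_{ue_i}\le\mathtt T_{ue_j}$, $\ \mathtt T_{ue_i}<\mathtt T_{ue_j}\Rightarrow\mathtt P_{ue_i}<\mathtt P_{ue_j}$, $\ \mathtt L_i=\mathrm{ID}(ue_j)\Leftrightarrow\mathtt P_{ue_j}=i$. Given an assignment $\nu$ satisfying $\varphi_{\mathit{run}}$ and $\varphi_{\mathit{trace}}$, for $1\le i\le m$ let $ue^{(i)}$ be the unique element of $\mathbf{ue}$ with $\mathrm{ID}(ue^{(i)})=\nu(\mathtt L_i)$, let $e_i=(\mathrm{ID}(ue^{(i)}),b,\hat\alpha)$ where $b{:}p$ is the $\nu(\mathtt A_{ue^{(i)}})$-th element of $\mathrm{LA}(ue^{(i)})$ and $\hat\alpha(v)=\nu(\mathtt D_{v,ue^{(i)}})$, and for $1\le j\le n$ let $f_j=(t_{\nu(\mathtt S_j)},\beta_j)$ with $\beta_j(v^r)=\nu(\mathtt X_{j-1,v})$, $\beta_j(v^w)=\nu(\mathtt X_{j,v})$. The expressions $[P_L]_i,[P_M]_j,[P_=]_{i,j},[\kappa_{\mathbf{ue}}]_i,[\theta_{\mathbf{ue}}]_i$ are encodings whose values under $\nu$ are $P_L(e_i)$, $P_M(f_j)$, $P_=(e_i,f_j)$; $conf(ue^{(i)})$ if $\nu(\mathtt{drop}_{ue^{(i)}})$ is true and $\infty$ otherwise; and $(1-conf(ue^{(i)}))+(1-p)$ if $\nu(\mathtt{drop}_{ue^{(i)}})$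 is false and $\infty$ otherwise, respectively. $\varphi_\delta$ is the conjunction, for all $1\le i\le m$, $1\le j\le n$, of: $\mathtt d_{0,0}=0$; $\mathtt d_{i,0}=\min([P_L]_i(1+[\theta_{\mathbf{ue}}]_i),[\kappa_{\mathbf{ue}}]_i)+\mathtt d_{i-1,0}$; $\mathtt d_{0,j}=[P_M]_j+\mathtt d_{0,j-1}$; and $\mathtt d_{i,j}$ equals the minimum of the four values (1) $c_{i,j}+\mathtt d_{i-1,j-1}$, where $c_{i,j}=[\theta_{\mathbf{ue}}]_i$ if $[P_=]_{i,j}=0$ and $c_{i,j}=[P_=]_{i,j}+[P_=]_{i,j}[\theta_{\mathbf{ue}}]_i$ otherwise; (2) $[P_L]_i(1+[\theta_{\mathbf{ue}}]_i)+\mathtt d_{i-1,j}$; (3) $[\kappa_{\mathbf{ue}}]_i+\mathtt d_{i-1,j}$; (4) $[P_M]_j+\mathtt d_{i,j-1}$. **Decoded alignment.** Let $e_i$ ($1\le i\le m$) be the event $(\mathrm{ID}(ue^{(i)}),b,\hat\alpha)$ read off from $\nu$, where $ue^{(i)}\in\mathbf{ue}$ has identifier $\nu(\mathtt L_i)$, $b$ is the label of the $\nu(\mathtt A_{ue^{(i)}})$-th element of $\mathrm{LA}(ue^{(i)})$ and $\hat\alpha(v)=\nu(\mathtt D_{v,ue^{(i)}})$ for all $v\in V$; and let $f_j$ ($1\le j\le n$) be the transition firing $(t_{\nu(\mathtt S_j)},\beta_j)$ with $\beta_j(v^r)=\nu(\mathtt X_{j-1,v})$ and $\beta_j(v^w)=\nu(\mathtt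 X_{j,v})$ for all $v\in V$. The sequences $\gamma_{i,j}$ are defined by $\gamma_{0,0}=\epsilon$; $\gamma_{0,j}=\gamma_{0,j-1}\cdot(\gg,f_j)$; $\gamma_{i,0}=\gamma_{i-1,0}\cdot(e_i,\gg)$ if $\nu(\mathtt d_{i,0})=\nu([P_L]_i(1+[\theta_{\mathbf{ue}}]_i)+\mathtt d_{i-1,0})$ and $\gamma_{i,0}=\gamma_{i-1,0}$ otherwise; and for $i,j\ge1$, taking the first case that applies: $\gamma_{i,j}=\gamma_{i-1,j}\cdot(e_i,\gg)$ if $\nu(\mathtt d_{i,j})=\nu([P_L]_i(1+[\theta_{\mathbf{ue}}]_i)+\mathtt d_{i-1,j})$; $\gamma_{i,j}=\gamma_{i-1,j}$ if $\nu(\mathtt d_{i,j})=\nu([\kappa_{\mathbf{ue}}]_i+\mathtt d_{i-1,j})$; $\gamma_{i,j}=\gamma_{i,j-1}\cdot(\gg,f_j)$ if $\nu(\mathtt d_{i,j})=\nu([P_M]_j+\mathtt d_{i,j-1})$; $\gamma_{i,j}=\gamma_{i-1,j-1}\cdot(e_i,f_j)$ otherwise. *)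

theory Defs
  imports Complex_Main "HOL-Library.FuncSet" "HOL-Library.Extended_Real"
begin

section \<open>Typed values and constraints\<close>

datatype vtype = TBool | TInt | TRat | TString

datatype val =
    BoolV (the_bool: bool)
  | IntV (the_int: int)
  | RatV (the_rat: rat)
  | StrV (the_str: string)

fun domain_of :: "vtype \<Rightarrow> val set" where
  "domain_of TBool = range BoolV"
| "domain_of TInt = range IntV"
| "domain_of TRat = range RatV"
| "domain_of TString = range StrV"

datatype 'x iterm = IVar 'x | IConst int | IAdd "'x iterm" "'x iterm" | INeg "'x iterm"
datatype 'x rterm = RVar 'x | RConst rat | RAdd "'x rterm" "'x rterm" | RNeg "'x rterm"
datatype 'x sterm = SVar 'x | SConst string

datatype (cvars: 'x) constr =
    BVar 'x
  | BConst bool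
  | IGe "'x iterm" "'x iterm"
  | RGe "'x rterm" "'x rterm"
  | RGt "'x rterm" "'x rterm"
  | SEq "'x sterm" "'x sterm"
  | CNot "'x constr"
  | CAnd "'x constr" "'x constr"
  | COr "'x constr" "'x constr"

primrec ieval :: "('x \<Rightarrow> val) \<Rightarrow> 'x iterm \<Rightarrow> int" where
  "ieval \<beta> (IVar x) = the_int (\<beta> x)"
| "ieval \<beta> (IConst k) = k"
| "ieval \<beta> (IAdd s t) = ieval \<beta> s + ieval \<beta> t"
| "ieval \<beta> (INeg s) = - ieval \<beta> s"

primrec reval :: "('x \<Rightarrow> val) \<Rightarrow> 'x rterm \<Rightarrow> rat" where
  "reval \<beta> (RVar x) = the_rat (\<beta> x)"
| "reval \<beta> (RConst q) = q"
| "reval \<beta> (RAdd s t) = reval \<beta> s + reval \<beta> t"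
| "reval \<beta> (RNeg s) = - reval \<beta> s"

primrec seval :: "('x \<Rightarrow> val) \<Rightarrow> 'x sterm \<Rightarrow> string" where
  "seval \<beta> (SVar x) = the_str (\<beta> x)"
| "seval \<beta> (SConst s) = s"

primrec sat :: "('x \<Rightarrow> val) \<Rightarrow> 'x constr \<Rightarrow> bool" where
  "sat \<beta> (BVar x) \<longleftrightarrow> the_bool (\<beta> x)"
| "sat \<beta> (BConst b) \<longleftrightarrow> b"
| "sat \<beta> (IGe s t) \<longleftrightarrow> ieval \<beta> s \<ge> ieval \<beta> t"
| "sat \<beta> (RGe s t) \<longleftrightarrow> reval \<beta> s \<ge> reval \<beta> t"
| "sat \<beta> (RGt s t) \<longleftrightarrow> reval \<beta> s > reval \<beta> t"
| "sat \<beta> (SEq s t) \<longleftrightarrow> seval \<beta> s = seval \<beta> t"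
| "sat \<beta> (CNot c) \<longleftrightarrow> \<not> sat \<beta> c"
| "sat \<beta> (CAnd c d) \<longleftrightarrow> sat \<beta> c \<and> sat \<beta> d"
| "sat \<beta> (COr c d) \<longleftrightarrow> sat \<beta> c \<or> sat \<beta> d"

primrec well_typed :: "('x \<Rightarrow> vtype) \<Rightarrow> 'x constr \<Rightarrow> bool" where
  "well_typed ty (BVar x) \<longleftrightarrow> ty x = TBool"
| "well_typed ty (BConst b) \<longleftrightarrow> True"
| "well_typed ty (IGe s t) \<longleftrightarrow> (\<forall>x \<in> set_iterm s \<union> set_iterm t. ty x = TInt)"
| "well_typed ty (RGe s t) \<longleftrightarrow> (\<forall>x \<in> set_rterm s \<union> set_rterm t. ty x = TRat)"
| "well_typed ty (RGt s t) \<longleftrightarrow> (\<forall>x \<in> set_rterm s \<union> set_rterm t. ty x = TRat)"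
| "well_typed ty (SEq s t) \<longleftrightarrow> (\<forall>x \<in> set_sterm s \<union> set_sterm t. ty x = TString)"
| "well_typed ty (CNot c) \<longleftrightarrow> well_typed ty c"
| "well_typed ty (CAnd c d) \<longleftrightarrow> well_typed ty c \<and> well_typed ty d"
| "well_typed ty (COr c d) \<longleftrightarrow> well_typed ty c \<and> well_typed ty d"


section \<open>Data Petri nets\<close>

text \<open>\<open>Rd v\<close> and \<open>Wr v\<close> are the read and written copies of the process variable \<open>v\<close>.\<close>

datatype 'v rw = Rd 'v | Wr 'v

primrec base :: "'v rw \<Rightarrow> 'v" where
  "base (Rd v) = v"
| "base (Wr v) = v"

text \<open>Places and transitions live in different types, so they are disjoint; accordingly the flow
  function is split into \<open>pre\<close> (arcs from places) and \<open>post\<close> (arcs to places).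
  A transition is silent if its label is \<open>None\<close>.\<close>

record ('p, 't, 'a, 'v) dpn =
  places :: "'p set"
  transitions :: "'t set"
  pre :: "'p \<Rightarrow> 't \<Rightarrow> nat"
  post :: "'t \<Rightarrow> 'p \<Rightarrow> nat"
  label :: "'t \<Rightarrow> 'a option"
  activities :: "'a set"
  pvars :: "'v set"
  vty :: "'v \<Rightarrow> vtype"
  guard :: "'t \<Rightarrow> 'v rw constr"
  init_marking :: "'p \<Rightarrow> nat"
  init_assign :: "'v \<Rightarrow> val"
  final_marking :: "'p \<Rightarrow> nat"

text \<open>Markings and assignments are extensional functions, so that two of them are equal as soon
  as they agree on the places (variables) of the net.\<close>

definition markings :: "('p, 't, 'a, 'v) dpn \<Rightarrow> ('p \<Rightarrow> nat) set" where
  "markings N = (places N \<rightarrow>\<^sub>E UNIV)"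

definition assigns :: "('p, 't, 'a, 'v) dpn \<Rightarrow> ('v \<Rightarrow> val) set" where
  "assigns N = (\<Pi>\<^sub>E v \<in> pvars N. domain_of (vty N v))"

definition silent :: "('p, 't, 'a, 'v) dpn \<Rightarrow> 't \<Rightarrow> bool" where
  "silent N t \<longleftrightarrow> label N t = None"

definition wrt :: "('p, 't, 'a, 'v) dpn \<Rightarrow> 't \<Rightarrow> 'v set" where
  "wrt N t = {v. Wr v \<in> cvars (guard N t)}"

definition is_dpn :: "('p, 't, 'a, 'v) dpn \<Rightarrow> bool" where
  "is_dpn N \<longleftrightarrow>
     finite (places N) \<and> places N \<noteq> {} \<and>
     finite (transitions N) \<and> transitions N \<noteq> {} \<and>
     finite (activities N) \<and> finite (pvars N) \<and>
     (\<forall>t \<in> transitions N. label N t \<in> insert None (Some ` activities N)) \<and>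
     (\<forall>t \<in> transitions N.
        base ` cvars (guard N t) \<subseteq> pvars N \<and>
        well_typed (\<lambda>x. vty N (base x)) (guard N t) \<and>
        (silent N t \<longrightarrow> wrt N t = {})) \<and>
     init_marking N \<in> markings N \<and> init_assign N \<in> assigns N \<and> final_marking N \<in> markings N"

type_synonym ('p, 'v) state = "('p \<Rightarrow> nat) \<times> ('v \<Rightarrow> val)"
type_synonym ('t, 'v) firing = "'t \<times> ('v rw \<Rightarrow> val)"

definition firings :: "('p, 't, 'a, 'v) dpn \<Rightarrow> ('t, 'v) firing set" where
  "firings N = transitions N \<times>
     (\<Pi>\<^sub>E x \<in> Rd ` pvars N \<union> Wr ` pvars N. domain_of (vty N (base x)))"

definition step ::
  "('p, 't, 'a, 'v) dpn \<Rightarrow> ('p, 'v) state \<Rightarrow> ('t, 'v) firing \<Rightarrow> ('p, 'v) state \<Rightarrow> bool" where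
  "step N s f s' \<longleftrightarrow>
     (case (s, f, s') of ((M, \<alpha>), (t, \<beta>), (M', \<alpha>')) \<Rightarrow>
        M \<in> markings N \<and> \<alpha> \<in> assigns N \<and> M' \<in> markings N \<and> \<alpha>' \<in> assigns N \<and>
        (t, \<beta>) \<in> firings N \<and>
        (\<forall>p \<in> places N. pre N p t \<le> M p \<and> M' p = M p - pre N p t + post N t p) \<and>
        (\<forall>v \<in> pvars N. \<beta> (Rd v) = \<alpha> v \<and> \<beta> (Wr v) = \<alpha>' v) \<and>
        sat \<beta> (guard N t) \<and>
        (\<forall>v \<in> pvars N - wrt N t. \<alpha>' v = \<alpha> v))"

primrec steps ::
  "('p, 't, 'a, 'v) dpn \<Rightarrow> ('p, 'v) state \<Rightarrow> ('t, 'v) firing list \<Rightarrow> ('p, 'v) state \<Rightarrow> bool" where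
  "steps N s [] s' \<longleftrightarrow> s = s'"
| "steps N s (f # fs) s' \<longleftrightarrow> (\<exists>s''. step N s f s'' \<and> steps N s'' fs s')"

definition runs :: "('p, 't, 'a, 'v) dpn \<Rightarrow> ('t, 'v) firing list set" where
  "runs N = {fs. \<exists>\<alpha>F. steps N (init_marking N, init_assign N) fs (final_marking N, \<alpha>F)}"


section \<open>Traces with uncertainty\<close>

record ('id, 'a, 'v) uevent =
  uid :: 'id
  conf :: real
  labs :: "('a \<times> real) set"
  stamps :: "nat set"
  uvals :: "'v \<Rightarrow> val set option"

definition is_uevent :: "('p, 't, 'a, 'v) dpn \<Rightarrow> ('id, 'a, 'v) uevent \<Rightarrow> bool" where
  "is_uevent N ue \<longleftrightarrow>
     0 < conf ue \<and> conf ue \<le> 1 \<and>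
     finite (labs ue) \<and> labs ue \<noteq> {} \<and> inj_on fst (labs ue) \<and>
     (\<forall>(b, p) \<in> labs ue. b \<in> activities N \<and> 0 < p \<and> p \<le> 1) \<and>
     (\<Sum>(b, p) \<in> labs ue. p) = 1 \<and>
     (finite (stamps ue) \<and> stamps ue \<noteq> {} \<or> (\<exists>l u. l \<le> u \<and> stamps ue = {l..u})) \<and>
     dom (uvals ue) \<subseteq> pvars N \<and>
     (\<forall>v S. uvals ue v = Some S \<longrightarrow>
        finite S \<and> S \<noteq> {} \<and> S \<subseteq> domain_of (vty N v) \<or>
        vty N v = TInt \<and> (\<exists>l u. l \<le> u \<and> S = IntV ` {l..u}) \<or>
        vty N v = TRat \<and> (\<exists>l u. l \<le> u \<and> S = RatV ` {l..u}))"

definition log_trace :: "('p, 't, 'a, 'v) dpn \<Rightarrow> ('id, 'a, 'v) uevent set \<Rightarrow> bool" where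
  "log_trace N U \<longleftrightarrow> finite U \<and> (\<forall>ue \<in> U. is_uevent N ue) \<and> inj_on uid U"

record ('id, 'a, 'v) event =
  eid :: 'id
  lab :: 'a
  vals :: "'v \<Rightarrow> val"

definition events :: "('p, 't, 'a, 'v) dpn \<Rightarrow> ('id, 'a, 'v) event set" where
  "events N = {e. lab e \<in> activities N \<and> vals e \<in> assigns N}"

definition realization ::
  "('p, 't, 'a, 'v) dpn \<Rightarrow> ('id, 'a, 'v) uevent set \<Rightarrow> ('id, 'a, 'v) event list \<Rightarrow> bool" where
  "realization N U es \<longleftrightarrow> set es \<subseteq> events N \<and>
     (\<exists>ues taus. length ues = length es \<and> length taus = length es \<and>
        distinct ues \<and> set ues \<subseteq> U \<and> sorted taus \<and>
        (\<forall>i < length es.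
           taus ! i \<in> stamps (ues ! i) \<and>
           eid (es ! i) = uid (ues ! i) \<and>
           (\<exists>p. (lab (es ! i), p) \<in> labs (ues ! i)) \<and>
           (\<forall>v S. uvals (ues ! i) v = Some S \<longrightarrow> vals (es ! i) v \<in> S)) \<and>
        {ue \<in> U. conf ue = 1} \<subseteq> set ues)"


section \<open>Alignments and costs\<close>

text \<open>The skip symbol is \<open>None\<close>.\<close>

type_synonym ('id, 't, 'a, 'v) move = "('id, 'a, 'v) event option \<times> ('t, 'v) firing option"

definition moves :: "('p, 't, 'a, 'v) dpn \<Rightarrow> ('id, 't, 'a, 'v) move set" where
  "moves N = (insert None (Some ` events N) \<times> insert None (Some ` firings N)) - {(None, None)}"

definition projL :: "('id, 't, 'a, 'v) move list \<Rightarrow> ('id, 'a, 'v) event list" where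
  "projL \<gamma> = List.map_filter fst \<gamma>"

definition projM :: "('id, 't, 'a, 'v) move list \<Rightarrow> ('t, 'v) firing list" where
  "projM \<gamma> = List.map_filter snd \<gamma>"

definition alignment ::
  "('p, 't, 'a, 'v) dpn \<Rightarrow> ('id, 'a, 'v) event list \<Rightarrow> ('id, 't, 'a, 'v) move list \<Rightarrow> bool" where
  "alignment N es \<gamma> \<longleftrightarrow> set \<gamma> \<subseteq> moves N \<and> projL \<gamma> = es \<and> projM \<gamma> \<in> runs N"

record ('id, 't, 'a, 'v) penalty =
  PL :: "('id, 'a, 'v) event \<Rightarrow> real"
  PM :: "('t, 'v) firing \<Rightarrow> real"
  PE :: "('id, 'a, 'v) event \<Rightarrow> ('t, 'v) firing \<Rightarrow> ereal"

definition is_penalty :: "('p, 't, 'a, 'v) dpn \<Rightarrow> ('id, 't, 'a, 'v) penalty \<Rightarrow> bool" where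
  "is_penalty N C \<longleftrightarrow>
     (\<forall>e \<in> events N. 0 < PL C e) \<and>
     (\<forall>f \<in> firings N. 0 \<le> PM C f \<and> (silent N (fst f) \<longrightarrow> PM C f = 0)) \<and>
     (\<forall>e \<in> events N. \<forall>f \<in> firings N. 0 \<le> PE C e f)"

definition theta :: "('id, 'a, 'v) uevent set \<Rightarrow> ('id, 'a, 'v) event \<Rightarrow> real" where
  "theta U e =
     (let ue = (THE ue. ue \<in> U \<and> uid ue = eid e);
          p = (THE p. (lab e, p) \<in> labs ue)
      in (1 - conf ue) + (1 - p))"

fun move_cost ::
  "('id, 't, 'a, 'v) penalty \<Rightarrow> ('id, 'a, 'v) uevent set \<Rightarrow> ('id, 't, 'a, 'v) move \<Rightarrow> ereal" where
  "move_cost C U (None, None) = 0"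
| "move_cost C U (None, Some f) = ereal (PM C f)"
| "move_cost C U (Some e, None) = ereal (PL C e * (1 + theta U e))"
| "move_cost C U (Some e, Some f) =
     (if PE C e f = 0 then ereal (theta U e) else PE C e f * ereal (1 + theta U e))"

definition alignment_cost ::
  "('id, 't, 'a, 'v) penalty \<Rightarrow> ('id, 'a, 'v) uevent set \<Rightarrow> ('id, 't, 'a, 'v) move list \<Rightarrow> ereal" where
  "alignment_cost C U \<gamma> = sum_list (map (move_cost C U) \<gamma>)"

definition removal_cost ::
  "('id, 'a, 'v) uevent set \<Rightarrow> ('id, 'a, 'v) event list \<Rightarrow> ereal" where
  "removal_cost U es =
     (\<Sum>ue \<in> {ue \<in> U. uid ue \<notin> eid ` set es}. if conf ue < 1 then ereal (conf ue) else \<infinity>)"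

text \<open>An alignment of \<open>es\<close> has log projection \<open>es\<close>, so the realization need not be an argument.\<close>

definition total_cost ::
  "('id, 't, 'a, 'v) penalty \<Rightarrow> ('id, 'a, 'v) uevent set \<Rightarrow> ('id, 't, 'a, 'v) move list \<Rightarrow> ereal" where
  "total_cost C U \<gamma> = alignment_cost C U \<gamma> + removal_cost U (projL \<gamma>)"

definition optimal ::
  "('p, 't, 'a, 'v) dpn \<Rightarrow> ('id, 't, 'a, 'v) penalty \<Rightarrow> ('id, 'a, 'v) uevent set \<Rightarrow>
   ('id, 't, 'a, 'v) move list \<Rightarrow> bool" where
  "optimal N C U \<gamma> \<longleftrightarrow>
     (\<exists>es. realization N U es \<and> alignment N es \<gamma>) \<and>
     \<not> (\<exists>es' \<gamma>'. realization N U es' \<and> alignment N es' \<gamma>' \<and> total_cost C U \<gamma>' < total_cost C U \<gamma>)"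


section \<open>Encoding\<close>

text \<open>The encoding depends on enumerations, without repetitions, of the transitions, of the
  log trace and of the label set of each event with uncertainty.\<close>

record ('id, 't, 'a, 'v) enums =
  tlist :: "'t list"
  ulist :: "('id, 'a, 'v) uevent list"
  llist :: "('id, 'a, 'v) uevent \<Rightarrow> ('a \<times> real) list"

definition is_enums ::
  "('p, 't, 'a, 'v) dpn \<Rightarrow> ('id, 'a, 'v) uevent set \<Rightarrow> ('id, 't, 'a, 'v) enums \<Rightarrow> bool" where
  "is_enums N U E \<longleftrightarrow>
     distinct (tlist E) \<and> set (tlist E) = transitions N \<and>
     distinct (ulist E) \<and> set (ulist E) = U \<and>
     (\<forall>ue \<in> U. distinct (llist E ue) \<and> set (llist E ue) = labs ue)"

text \<open>An assignment to the variables of the encoding.  The numeric variables \<open>vd\<close> are real, while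
  the expressions they are equated with are evaluated in the extended reals.\<close>

record ('id, 'p, 'a, 'v) enc =
  vS :: "nat \<Rightarrow> int"
  vM :: "nat \<Rightarrow> 'p \<Rightarrow> int"
  vX :: "nat \<Rightarrow> 'v \<Rightarrow> val"
  vdrop :: "('id, 'a, 'v) uevent \<Rightarrow> bool"
  vA :: "('id, 'a, 'v) uevent \<Rightarrow> int"
  vT :: "('id, 'a, 'v) uevent \<Rightarrow> int"
  vP :: "('id, 'a, 'v) uevent \<Rightarrow> int"
  vD :: "'v \<Rightarrow> ('id, 'a, 'v) uevent \<Rightarrow> val"
  vL :: "nat \<Rightarrow> 'id"
  vd :: "nat \<Rightarrow> nat \<Rightarrow> real"

text \<open>The typing conditions on the variables that are not already enforced by the record type.\<close>

definition enc_typed ::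
  "('p, 't, 'a, 'v) dpn \<Rightarrow> ('id, 't, 'a, 'v) enums \<Rightarrow> nat \<Rightarrow> ('id, 'p, 'a, 'v) enc \<Rightarrow> bool" where
  "enc_typed N E n \<nu> \<longleftrightarrow>
     (\<forall>v \<in> pvars N.
        (\<forall>i \<le> n. vX \<nu> i v \<in> domain_of (vty N v)) \<and>
        (\<forall>ue \<in> set (ulist E). vD \<nu> v ue \<in> domain_of (vty N v)))"

definition phi_run ::
  "('p, 't, 'a, 'v) dpn \<Rightarrow> ('id, 't, 'a, 'v) enums \<Rightarrow> nat \<Rightarrow> ('id, 'p, 'a, 'v) enc \<Rightarrow> bool" where
  "phi_run N E n \<nu> \<longleftrightarrow>
     (\<forall>p \<in> places N. vM \<nu> 0 p = int (init_marking N p) \<and> vM \<nu> n p = int (final_marking N p)) \<and>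
     (\<forall>v \<in> pvars N. vX \<nu> 0 v = init_assign N v) \<and>
     (\<forall>i \<in> {1..n}. 1 \<le> vS \<nu> i \<and> vS \<nu> i \<le> int (card (transitions N))) \<and>
     (\<forall>i \<in> {1..n}. \<forall>j \<in> {1..card (transitions N)}. vS \<nu> i = int j \<longrightarrow>
        (let t = tlist E ! (j - 1) in
           (\<forall>p \<in> {p \<in> places N. pre N p t > 0}. vM \<nu> (i - 1) p \<ge> int (pre N p t)) \<and>
           (\<forall>p \<in> places N. vM \<nu> i p - vM \<nu> (i - 1) p = int (post N t p) - int (pre N p t)) \<and>
           sat (case_rw (vX \<nu> (i - 1)) (vX \<nu> i)) (guard N t) \<and>
           (\<forall>v \<in> pvars N - wrt N t. vX \<nu> (i - 1) v = vX \<nu> i v)))"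

definition phi_trace ::
  "('id, 't, 'a, 'v) enums \<Rightarrow> ('id, 'p, 'a, 'v) enc \<Rightarrow> bool" where
  "phi_trace E \<nu> \<longleftrightarrow>
     (let us = ulist E; m = length us in
        (\<forall>ue \<in> set us.
           (vdrop \<nu> ue \<longrightarrow> conf ue < 1) \<and>
           1 \<le> vA \<nu> ue \<and> vA \<nu> ue \<le> int (card (labs ue)) \<and>
           (\<forall>v S. uvals ue v = Some S \<longrightarrow> vD \<nu> v ue \<in> S) \<and>
           vT \<nu> ue \<in> int ` stamps ue) \<and>
        (\<forall>j \<in> {1..m}. vL \<nu> j \<in> uid ` set us) \<and>
        (\<forall>i \<in> {1..m}. \<forall>j \<in> {1..m}.
           (let ui = us ! (i - 1); uj = us ! (j - 1) in
              (vP \<nu> ui < vP \<nu> uj \<longrightarrow> vT \<nu> ui \<le> vT \<nu> uj) \<and>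
              (vT \<nu> ui < vT \<nu> uj \<longrightarrow> vP \<nu> ui < vP \<nu> uj) \<and>
              (vL \<nu> i = uid uj \<longleftrightarrow> vP \<nu> uj = int i))))"

text \<open>The events with uncertainty, label entries, events and firings read off from \<open>\<nu>\<close>, for
  indices starting at 1.\<close>

definition dec_uevent ::
  "('id, 't, 'a, 'v) enums \<Rightarrow> ('id, 'p, 'a, 'v) enc \<Rightarrow> nat \<Rightarrow> ('id, 'a, 'v) uevent" where
  "dec_uevent E \<nu> i = (THE ue. ue \<in> set (ulist E) \<and> uid ue = vL \<nu> i)"

definition dec_entry ::
  "('id, 't, 'a, 'v) enums \<Rightarrow> ('id, 'p, 'a, 'v) enc \<Rightarrow> nat \<Rightarrow> 'a \<times> real" where
  "dec_entry E \<nu> i = (let ue = dec_uevent E \<nu> i in llist E ue ! (nat (vA \<nu> ue) - 1))"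

definition dec_event ::
  "('p, 't, 'a, 'v) dpn \<Rightarrow> ('id, 't, 'a, 'v) enums \<Rightarrow> ('id, 'p, 'a, 'v) enc \<Rightarrow> nat \<Rightarrow>
   ('id, 'a, 'v) event" where
  "dec_event N E \<nu> i =
     (let ue = dec_uevent E \<nu> i in
        \<lparr>eid = uid ue, lab = fst (dec_entry E \<nu> i), vals = (\<lambda>v \<in> pvars N. vD \<nu> v ue)\<rparr>)"

definition dec_firing ::
  "('p, 't, 'a, 'v) dpn \<Rightarrow> ('id, 't, 'a, 'v) enums \<Rightarrow> ('id, 'p, 'a, 'v) enc \<Rightarrow> nat \<Rightarrow>
   ('t, 'v) firing" where
  "dec_firing N E \<nu> j =
     (tlist E ! (nat (vS \<nu> j) - 1),
      restrict (case_rw (vX \<nu> (j - 1)) (vX \<nu> j)) (Rd ` pvars N \<union> Wr ` pvars N))"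

text \<open>The values under \<open>\<nu>\<close> of the encodings of the penalties, of the removal cost, and of the
  confidence term.\<close>

definition enc_PL ::
  "('p, 't, 'a, 'v) dpn \<Rightarrow> ('id, 't, 'a, 'v) enums \<Rightarrow> ('id, 't, 'a, 'v) penalty \<Rightarrow>
   ('id, 'p, 'a, 'v) enc \<Rightarrow> nat \<Rightarrow> ereal" where
  "enc_PL N E C \<nu> i = ereal (PL C (dec_event N E \<nu> i))"

definition enc_PM ::
  "('p, 't, 'a, 'v) dpn \<Rightarrow> ('id, 't, 'a, 'v) enums \<Rightarrow> ('id, 't, 'a, 'v) penalty \<Rightarrow>
   ('id, 'p, 'a, 'v) enc \<Rightarrow> nat \<Rightarrow> ereal" where
  "enc_PM N E C \<nu> j = ereal (PM C (dec_firing N E \<nu> j))"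

definition enc_PE ::
  "('p, 't, 'a, 'v) dpn \<Rightarrow> ('id, 't, 'a, 'v) enums \<Rightarrow> ('id, 't, 'a, 'v) penalty \<Rightarrow>
   ('id, 'p, 'a, 'v) enc \<Rightarrow> nat \<Rightarrow> nat \<Rightarrow> ereal" where
  "enc_PE N E C \<nu> i j = PE C (dec_event N E \<nu> i) (dec_firing N E \<nu> j)"

definition enc_kappa ::
  "('id, 't, 'a, 'v) enums \<Rightarrow> ('id, 'p, 'a, 'v) enc \<Rightarrow> nat \<Rightarrow> ereal" where
  "enc_kappa E \<nu> i =
     (let ue = dec_uevent E \<nu> i in if vdrop \<nu> ue then ereal (conf ue) else \<infinity>)"

definition enc_theta ::
  "('id, 't, 'a, 'v) enums \<Rightarrow> ('id, 'p, 'a, 'v) enc \<Rightarrow> nat \<Rightarrow> ereal" where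
  "enc_theta E \<nu> i =
     (let ue = dec_uevent E \<nu> i in
        if vdrop \<nu> ue then \<infinity> else ereal ((1 - conf ue) + (1 - snd (dec_entry E \<nu> i))))"

definition enc_log_cost ::
  "('p, 't, 'a, 'v) dpn \<Rightarrow> ('id, 't, 'a, 'v) enums \<Rightarrow> ('id, 't, 'a, 'v) penalty \<Rightarrow>
   ('id, 'p, 'a, 'v) enc \<Rightarrow> nat \<Rightarrow> ereal" where
  "enc_log_cost N E C \<nu> i = enc_PL N E C \<nu> i * (1 + enc_theta E \<nu> i)"

definition enc_sync_cost ::
  "('p, 't, 'a, 'v) dpn \<Rightarrow> ('id, 't, 'a, 'v) enums \<Rightarrow> ('id, 't, 'a, 'v) penalty \<Rightarrow>
   ('id, 'p, 'a, 'v) enc \<Rightarrow> nat \<Rightarrow> nat \<Rightarrow> ereal" where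
  "enc_sync_cost N E C \<nu> i j =
     (if enc_PE N E C \<nu> i j = 0 then enc_theta E \<nu> i
      else enc_PE N E C \<nu> i j + enc_PE N E C \<nu> i j * enc_theta E \<nu> i)"

definition phi_delta ::
  "('p, 't, 'a, 'v) dpn \<Rightarrow> ('id, 't, 'a, 'v) enums \<Rightarrow> ('id, 't, 'a, 'v) penalty \<Rightarrow> nat \<Rightarrow>
   ('id, 'p, 'a, 'v) enc \<Rightarrow> bool" where
  "phi_delta N E C n \<nu> \<longleftrightarrow>
     (let m = length (ulist E); d = (\<lambda>i j. ereal (vd \<nu> i j)) in
        d 0 0 = 0 \<and>
        (\<forall>i \<in> {1..m}. d i 0 = min (enc_log_cost N E C \<nu> i) (enc_kappa E \<nu> i) + d (i - 1) 0) \<and>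
        (\<forall>j \<in> {1..n}. d 0 j = enc_PM N E C \<nu> j + d 0 (j - 1)) \<and>
        (\<forall>i \<in> {1..m}. \<forall>j \<in> {1..n}. d i j =
           Min {enc_sync_cost N E C \<nu> i j + d (i - 1) (j - 1),
                enc_log_cost N E C \<nu> i + d (i - 1) j,
                enc_kappa E \<nu> i + d (i - 1) j,
                enc_PM N E C \<nu> j + d i (j - 1)}))"

definition feasible ::
  "('p, 't, 'a, 'v) dpn \<Rightarrow> ('id, 't, 'a, 'v) enums \<Rightarrow> ('id, 't, 'a, 'v) penalty \<Rightarrow> nat \<Rightarrow>
   ('id, 'p, 'a, 'v) enc \<Rightarrow> bool" where
  "feasible N E C n \<nu> \<longleftrightarrow>
     enc_typed N E n \<nu> \<and> phi_run N E n \<nu> \<and> phi_trace E \<nu> \<and> phi_delta N E C n \<nu>"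

definition solution ::
  "('p, 't, 'a, 'v) dpn \<Rightarrow> ('id, 't, 'a, 'v) enums \<Rightarrow> ('id, 't, 'a, 'v) penalty \<Rightarrow> nat \<Rightarrow>
   ('id, 'p, 'a, 'v) enc \<Rightarrow> bool" where
  "solution N E C n \<nu> \<longleftrightarrow> feasible N E C n \<nu> \<and>
     (\<forall>\<nu>'. feasible N E C n \<nu>' \<longrightarrow>
        vd \<nu> (length (ulist E)) n \<le> vd \<nu>' (length (ulist E)) n)"

fun decode ::
  "('p, 't, 'a, 'v) dpn \<Rightarrow> ('id, 't, 'a, 'v) enums \<Rightarrow> ('id, 't, 'a, 'v) penalty \<Rightarrow>
   ('id, 'p, 'a, 'v) enc \<Rightarrow> nat \<Rightarrow> nat \<Rightarrow> ('id, 't, 'a, 'v) move list" where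
  "decode N E C \<nu> 0 0 = []"
| "decode N E C \<nu> 0 (Suc j) =
     decode N E C \<nu> 0 j @ [(None, Some (dec_firing N E \<nu> (Suc j)))]"
| "decode N E C \<nu> (Suc i) 0 =
     (if ereal (vd \<nu> (Suc i) 0) = enc_log_cost N E C \<nu> (Suc i) + ereal (vd \<nu> i 0)
      then decode N E C \<nu> i 0 @ [(Some (dec_event N E \<nu> (Suc i)), None)]
      else decode N E C \<nu> i 0)"
| "decode N E C \<nu> (Suc i) (Suc j) =
     (if ereal (vd \<nu> (Suc i) (Suc j)) = enc_log_cost N E C \<nu> (Suc i) + ereal (vd \<nu> i (Suc j))
      then decode N E C \<nu> i (Suc j) @ [(Some (dec_event N E \<nu> (Suc i)), None)]
      else if ereal (vd \<nu> (Suc i) (Suc j)) = enc_kappa E \<nu> (Suc i) + ereal (vd \<nu> i (Suc j))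
      then decode N E C \<nu> i (Suc j)
      else if ereal (vd \<nu> (Suc i) (Suc j)) = enc_PM N E C \<nu> (Suc j) + ereal (vd \<nu> (Suc i) j)
      then decode N E C \<nu> (Suc i) j @ [(None, Some (dec_firing N E \<nu> (Suc j)))]
      else decode N E C \<nu> i j @
             [(Some (dec_event N E \<nu> (Suc i)), Some (dec_firing N E \<nu> (Suc j)))])"

end

(*
  Fix an assignment satisfying the run and trace constraints. The events it does not drop form a
  realization, its firings form a run of length n, and the recursion for d is that of an edit
  distance in which a dropped event can only be removed (at the cost of its confidence) and a kept
  event can only be matched or skipped, because exactly one of the removal cost and the confidence
  term is finite. Hence d(m,n) is the cost of the decoded alignment and a lower bound for the cost of
  every alignment of the decoded realization with the decoded run. Conversely, an optimal alignment
  can be padded by the free silent loop until its run has length exactly n, and its realization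
  and run are those decoded from some satisfying assignment. So the minimum of d(m,n) is the
  optimal cost, and it is attained by the decoded alignment.
*)
theory Submission
  imports Defs
begin

section \<open>Evaluation and runs\<close>

lemma ieval_cong: "(\<And>x. x \<in> set_iterm s \<Longrightarrow> \<beta> x = \<beta>' x) \<Longrightarrow> ieval \<beta> s = ieval \<beta>' s"
  by (induction s) auto

lemma reval_cong: "(\<And>x. x \<in> set_rterm s \<Longrightarrow> \<beta> x = \<beta>' x) \<Longrightarrow> reval \<beta> s = reval \<beta>' s"
  by (induction s) auto

lemma seval_cong: "(\<And>x. x \<in> set_sterm s \<Longrightarrow> \<beta> x = \<beta>' x) \<Longrightarrow> seval \<beta> s = seval \<beta>' s"
  by (cases s) auto

text \<open>The encoding evaluates a guard under an assignment of all indexed copies, whereas a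
  firing carries a restricted one; the two agree on the variables that occur in the guard.\<close>

lemma sat_cong:
  assumes "\<And>x. x \<in> cvars c \<Longrightarrow> \<beta> x = \<beta>' x"
  shows "sat \<beta> c = sat \<beta>' c"
  using assms
proof (induction c)
  case (IGe s t)
  then show ?case using ieval_cong[of s \<beta> \<beta>'] ieval_cong[of t \<beta> \<beta>'] by simp
next
  case (RGe s t)
  then show ?case using reval_cong[of s \<beta> \<beta>'] reval_cong[of t \<beta> \<beta>'] by simp
next
  case (RGt s t)
  then show ?case using reval_cong[of s \<beta> \<beta>'] reval_cong[of t \<beta> \<beta>'] by simp
next
  case (SEq s t)
  then show ?case using seval_cong[of s \<beta> \<beta>'] seval_cong[of t \<beta> \<beta>'] by simp
next
  case (CAnd c d)
  have "sat \<beta> c = sat \<beta>' c" "sat \<beta> d = sat \<beta>' d" using CAnd by auto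
  then show ?case by simp
next
  case (COr c d)
  have "sat \<beta> c = sat \<beta>' c" "sat \<beta> d = sat \<beta>' d" using COr by auto
  then show ?case by simp
qed auto

text \<open>The recursion of \<open>steps\<close> hides the intermediate states. Indexing them by
  time matches the variables \<open>vM\<close> and \<open>vX\<close>, so this form is used both to
  read a run off an assignment and to write one into it.\<close>

lemma steps_iff_states:
  "steps N s fs s' \<longleftrightarrow>
     (\<exists>\<sigma>. \<sigma> 0 = s \<and> \<sigma> (length fs) = s' \<and> (\<forall>i < length fs. step N (\<sigma> i) (fs ! i) (\<sigma> (Suc i))))"
proof (induction fs arbitrary: s)
  case Nil
  then show ?case by (auto intro: exI[of _ "\<lambda>_. s"])
next
  case (Cons f fs)
  show ?case
  proof
    assume "steps N s (f # fs) s'"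
    then obtain s'' where 1: "step N s f s''" "steps N s'' fs s'" by auto
    then obtain \<sigma> where \<sigma>: "\<sigma> 0 = s''" "\<sigma> (length fs) = s'"
      "\<forall>i < length fs. step N (\<sigma> i) (fs ! i) (\<sigma> (Suc i))"
      using Cons.IH by blast
    have "step N (case_nat s \<sigma> i) ((f # fs) ! i) (case_nat s \<sigma> (Suc i))" if "i < length (f # fs)" for i
      using that \<sigma> 1 by (cases i) auto
    then show "\<exists>\<sigma>. \<sigma> 0 = s \<and> \<sigma> (length (f # fs)) = s' \<and>
        (\<forall>i < length (f # fs). step N (\<sigma> i) ((f # fs) ! i) (\<sigma> (Suc i)))"
      using \<sigma> by (intro exI[of _ "case_nat s \<sigma>"]) auto
  next
    assume "\<exists>\<sigma>. \<sigma> 0 = s \<and> \<sigma> (length (f # fs)) = s' \<and>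
        (\<forall>i < length (f # fs). step N (\<sigma> i) ((f # fs) ! i) (\<sigma> (Suc i)))"
    then obtain \<sigma> where \<sigma>: "\<sigma> 0 = s" "\<sigma> (length (f # fs)) = s'"
      "\<forall>i < length (f # fs). step N (\<sigma> i) ((f # fs) ! i) (\<sigma> (Suc i))" by blast
    have "steps N (\<sigma> 1) fs s'"
      unfolding Cons.IH using \<sigma> by (intro exI[of _ "\<lambda>i. \<sigma> (Suc i)"]) auto
    moreover have "step N s f (\<sigma> 1)" using \<sigma> by force
    ultimately show "steps N s (f # fs) s'" by (auto simp del: split_paired_Ex)
  qed
qed

lemma steps_append: "steps N s (fs @ gs) s' \<longleftrightarrow> (\<exists>s''. steps N s fs s'' \<and> steps N s'' gs s')"
  by (induction fs arbitrary: s) auto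

lemma steps_replicate_loop: "step N s f s \<Longrightarrow> steps N s (replicate k f) s"
  by (induction k) (auto simp del: split_paired_Ex)

lemma step_assigns: "step N s f s' \<Longrightarrow> snd s \<in> assigns N \<and> snd s' \<in> assigns N"
  by (auto simp: step_def split: prod.splits)

lemma steps_assigns: "steps N s fs s' \<Longrightarrow> snd s \<in> assigns N \<Longrightarrow> snd s' \<in> assigns N"
  by (induction fs arbitrary: s) (auto dest: step_assigns)

lemma step_firings: "step N s f s' \<Longrightarrow> f \<in> firings N"
  by (auto simp: step_def split: prod.splits)


section \<open>Lists of moves\<close>

lemma projL_append [simp]: "projL (xs @ ys) = projL xs @ projL ys"
  by (simp add: projL_def List.map_filter_def)

lemma projM_append [simp]: "projM (xs @ ys) = projM xs @ projM ys"
  by (simp add: projM_def List.map_filter_def)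

lemma projL_simps [simp]:
  "projL [] = []" "projL [(None, g)] = []" "projL [(Some e, g)] = [e]"
  by (simp_all add: projL_def List.map_filter_def)

lemma projM_simps [simp]:
  "projM [] = []" "projM [(g, None)] = []" "projM [(g, Some f)] = [f]"
  by (simp_all add: projM_def List.map_filter_def)

lemma alignment_cost_simps [simp]:
  "alignment_cost C U [] = 0"
  "alignment_cost C U (xs @ ys) = alignment_cost C U xs + alignment_cost C U ys"
  "alignment_cost C U [mv] = move_cost C U mv"
  by (simp_all add: alignment_cost_def)

lemma projL_map_silent [simp]: "projL (map (\<lambda>f. (None, Some f)) fs) = []"
  by (simp add: projL_def List.map_filter_def)

lemma projM_map_silent [simp]: "projM (map (\<lambda>f. (None, Some f)) fs) = fs"
  by (simp add: projM_def List.map_filter_def comp_def)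

text \<open>These shapes serve the induction for the lower bound on \<open>d\<close>:
  \<open>c\<close> joins the removal part when an event is dropped, and the alignment part when it
  is the cost of the last move.\<close>

lemma add_cost_le:
  fixes x :: ereal
  assumes "x \<le> a + r"
  shows "c + x \<le> a + (r + c)" "c + x \<le> a + c + r"
  using add_left_mono[OF assms, of c] by (simp_all add: ac_simps)

text \<open>Supplies the inverse of \<open>nth\<close>, by which transitions and uncertain events
  are turned into the numbers that the encoding uses.\<close>

lemma distinct_position:
  assumes "distinct xs"
  obtains pos where "\<And>k. k < length xs \<Longrightarrow> pos (xs ! k) = k"
    "\<And>x. x \<in> set xs \<Longrightarrow> pos x < length xs \<and> xs ! pos x = x"
proof -
  have inj: "inj_on ((!) xs) {..<length xs}"
    using assms by (simp add: inj_on_nth)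
  let ?pos = "the_inv_into {..<length xs} ((!) xs)"
  have 1: "?pos (xs ! k) = k" if "k < length xs" for k
    using the_inv_into_f_f[OF inj] that by simp
  moreover have "?pos x < length xs \<and> xs ! ?pos x = x" if x: "x \<in> set xs" for x
    using 1 x by (metis in_set_conv_nth)
  ultimately show thesis using that by blast
qed


section \<open>Decoding an assignment\<close>

locale uncertain_trace =
  fixes N :: "('p, 't, 'a, 'v) dpn"
    and U :: "('id, 'a, 'v) uevent set"
    and C :: "('id, 't, 'a, 'v) penalty"
    and E :: "('id, 't, 'a, 'v) enums"
  assumes dpn: "is_dpn N"
    and trace: "log_trace N U"
    and penalty: "is_penalty N C"
    and enums: "is_enums N U E"
begin

lemma set_ulist: "set (ulist E) = U" and length_ulist: "length (ulist E) = card U"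
  using enums by (auto simp: is_enums_def distinct_card[symmetric])

lemma set_tlist: "set (tlist E) = transitions N"
  and length_tlist: "length (tlist E) = card (transitions N)"
  and distinct_tlist: "distinct (tlist E)"
  using enums by (auto simp: is_enums_def distinct_card[symmetric])

lemma finite_U: "finite U" and inj_uid: "inj_on uid U"
  using trace by (auto simp: log_trace_def)

lemma uid_inject: "ue \<in> U \<Longrightarrow> ue' \<in> U \<Longrightarrow> uid ue = uid ue' \<Longrightarrow> ue = ue'"
  by (meson inj_onD inj_uid)

lemma uevent: "ue \<in> U \<Longrightarrow> is_uevent N ue"
  using trace by (auto simp: log_trace_def)

lemma llist:
  assumes "ue \<in> U"
  shows "set (llist E ue) = labs ue" "length (llist E ue) = card (labs ue)"
  using assms enums by (auto simp: is_enums_def distinct_card[symmetric])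

lemma guard_vars:
  assumes "t \<in> transitions N" "x \<in> cvars (guard N t)"
  shows "x \<in> Rd ` pvars N \<union> Wr ` pvars N"
proof -
  have "base ` cvars (guard N t) \<subseteq> pvars N" using dpn assms(1) by (simp add: is_dpn_def)
  then have "base x \<in> pvars N" using assms(2) by blast
  then show ?thesis by (cases x) auto
qed

text \<open>Identifiers are distinct within \<open>U\<close> and labels within
  \<open>labs ue\<close>, so both definite descriptions in \<open>theta\<close> pick out the
  intended objects; the sign follows from confidences being at most 1.\<close>

lemma theta_eq:
  assumes "ue \<in> U" "eid e = uid ue" "(lab e, p) \<in> labs ue"
  shows "theta U e = (1 - conf ue) + (1 - p)" "0 \<le> theta U e"
proof -
  have "(THE ue. ue \<in> U \<and> uid ue = eid e) = ue"
    using assms uid_inject by (intro the_equality) (simp, metis)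
  moreover have "inj_on fst (labs ue)"
    using uevent[OF assms(1)] by (auto simp: is_uevent_def)
  then have "(THE p. (lab e, p) \<in> labs ue) = p"
    using assms(3) by (intro the_equality) (simp, metis fst_conv inj_onD snd_conv)
  ultimately show eq: "theta U e = (1 - conf ue) + (1 - p)" by (simp add: theta_def)
  show "0 \<le> theta U e"
    unfolding eq using uevent[OF assms(1)] assms(3) by (auto simp: is_uevent_def)
qed

end

text \<open>The constraint \<open>phi_delta\<close> is left out on purpose: in this setting suitable
  distances are shown to exist, and only the later extension assumes them.\<close>

locale decoded = uncertain_trace N U C E
  for N :: "('p, 't, 'a, 'v) dpn"
    and U :: "('id, 'a, 'v) uevent set"
    and C :: "('id, 't, 'a, 'v) penalty"
    and E :: "('id, 't, 'a, 'v) enums" +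
  fixes n :: nat
    and \<nu> :: "('id, 'p, 'a, 'v) enc"
  assumes typed: "enc_typed N E n \<nu>"
    and run: "phi_run N E n \<nu>"
    and ordered: "phi_trace E \<nu>"
begin

abbreviation "u \<equiv> dec_uevent E \<nu>"
abbreviation "ev \<equiv> dec_event N E \<nu>"
abbreviation "fi \<equiv> dec_firing N E \<nu>"

section \<open>Prefixes of the decoded trace and run\<close>

definition events_upto :: "nat \<Rightarrow> ('id, 'a, 'v) event list" where
  "events_upto i = map ev (filter (\<lambda>l. \<not> vdrop \<nu> (u l)) [1..<Suc i])"

definition firings_upto :: "nat \<Rightarrow> ('t, 'v) firing list" where
  "firings_upto j = map fi [1..<Suc j]"

text \<open>The infinite case of the removal cost is absent because \<open>phi_trace\<close> lets an
  event be dropped only if its confidence is below 1.\<close>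

definition removal_upto :: "nat \<Rightarrow> ereal" where
  "removal_upto i = (\<Sum>l = 1..i. if vdrop \<nu> (u l) then ereal (conf (u l)) else 0)"

lemma events_upto_simps [simp]:
  "events_upto 0 = []"
  "events_upto (Suc i) = events_upto i @ (if vdrop \<nu> (u (Suc i)) then [] else [ev (Suc i)])"
  by (simp_all add: events_upto_def)

lemma firings_upto_simps [simp]:
  "firings_upto 0 = []" "firings_upto (Suc j) = firings_upto j @ [fi (Suc j)]"
  by (simp_all add: firings_upto_def)

lemma removal_upto_simps [simp]:
  "removal_upto 0 = 0"
  "removal_upto (Suc i) =
     removal_upto i + (if vdrop \<nu> (u (Suc i)) then ereal (conf (u (Suc i))) else 0)"
  by (simp_all add: removal_upto_def)

text \<open>The equivalence in \<open>phi_trace\<close> between the identifier at position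
  \<open>i\<close> and the position variable makes \<open>vP \<nu>\<close> the inverse of the
  enumeration \<open>u\<close>.\<close>

lemma dec_uevent_correct:
  assumes "i \<in> {1..card U}"
  shows "u i \<in> U" "uid (u i) = vL \<nu> i" "vP \<nu> (u i) = int i"
proof -
  have "vL \<nu> i \<in> uid ` U"
    using ordered assms by (auto simp: phi_trace_def Let_def length_ulist set_ulist)
  then obtain ue where ue: "ue \<in> U" "uid ue = vL \<nu> i" by auto
  then have eq: "u i = ue"
    unfolding dec_uevent_def set_ulist
    using uid_inject by (intro the_equality) (simp, metis)
  then show "u i \<in> U" "uid (u i) = vL \<nu> i" using ue by auto
  \<comment> \<open>The constraints address \<open>ue\<close> by its 1-based index in
    \<open>ulist E\<close>, which is unrelated to its decoded position \<open>i\<close>.\<close>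
  from ue(1) obtain k where "k < card U" "ulist E ! k = ue"
    by (metis set_ulist length_ulist in_set_conv_nth)
  then have k: "Suc k \<in> {1..card U}" "ulist E ! (Suc k - 1) = ue" by auto
  have "\<forall>i \<in> {1..card U}. \<forall>j \<in> {1..card U}.
      vL \<nu> i = uid (ulist E ! (j - 1)) \<longleftrightarrow> vP \<nu> (ulist E ! (j - 1)) = int i"
    using ordered by (auto simp: phi_trace_def Let_def length_ulist)
  then have "vL \<nu> i = uid ue \<longleftrightarrow> vP \<nu> ue = int i"
    using assms k by metis
  then show "vP \<nu> (u i) = int i" using ue eq by simp
qed

lemma dec_uevent_inj: "inj_on u {1..card U}"
  by (rule inj_onI) (metis dec_uevent_correct(3) of_nat_eq_iff)

text \<open>An injection into a finite set from an index set of the same size is onto, so every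
  uncertain event receives exactly one position.\<close>

lemma dec_uevent_image: "u ` {1..card U} = U"
  using dec_uevent_correct(1) dec_uevent_inj finite_U
  by (intro card_subset_eq) (auto simp: card_image)

lemma timestamps_sorted:
  assumes "1 \<le> i" "i \<le> i'" "i' \<le> card U"
  shows "vT \<nu> (u i) \<le> vT \<nu> (u i')"
proof (cases "i = i'")
  case False
  with assms have lt: "vP \<nu> (u i) < vP \<nu> (u i')"
    by (simp add: dec_uevent_correct)
  have "u i \<in> U" "u i' \<in> U" using assms dec_uevent_correct by auto
  then obtain k k' where "k < card U" "k' < card U" "ulist E ! k = u i" "ulist E ! k' = u i'"
    by (metis set_ulist length_ulist in_set_conv_nth)
  then have k: "Suc k \<in> {1..card U}" "Suc k' \<in> {1..card U}"
    "ulist E ! (Suc k - 1) = u i" "ulist E ! (Suc k' - 1) = u i'" by auto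
  have "\<forall>i \<in> {1..card U}. \<forall>j \<in> {1..card U}.
      vP \<nu> (ulist E ! (i - 1)) < vP \<nu> (ulist E ! (j - 1)) \<longrightarrow>
      vT \<nu> (ulist E ! (i - 1)) \<le> vT \<nu> (ulist E ! (j - 1))"
    using ordered by (simp add: phi_trace_def Let_def length_ulist)
  then show ?thesis using k lt by metis
qed simp

lemma uevent_constraints:
  assumes "ue \<in> U"
  shows "vdrop \<nu> ue \<Longrightarrow> conf ue < 1" "1 \<le> vA \<nu> ue" "vA \<nu> ue \<le> int (card (labs ue))"
    "\<And>v S. uvals ue v = Some S \<Longrightarrow> vD \<nu> v ue \<in> S" "vT \<nu> ue \<in> int ` stamps ue"
  using ordered assms by (auto simp: phi_trace_def Let_def set_ulist)

lemma dec_entry_labs: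
  assumes "i \<in> {1..card U}"
  shows "dec_entry E \<nu> i \<in> labs (u i)"
proof -
  have U: "u i \<in> U" using assms by (rule dec_uevent_correct)
  have "nat (vA \<nu> (u i)) - 1 < length (llist E (u i))"
    using uevent_constraints(2,3)[OF U] llist(2)[OF U] by linarith
  then show ?thesis
    using nth_mem llist(1)[OF U] by (fastforce simp: dec_entry_def Let_def)
qed

lemma eid_lab_dec_event:
  "eid (ev i) = uid (u i)" "(lab (ev i), snd (dec_entry E \<nu> i)) = dec_entry E \<nu> i"
  by (simp_all add: dec_event_def Let_def)

lemma dec_event_events:
  assumes "i \<in> {1..card U}"
  shows "ev i \<in> events N"
proof -
  have "lab (ev i) \<in> activities N"
    using uevent[OF dec_uevent_correct(1)[OF assms]] dec_entry_labs[OF assms] eid_lab_dec_event(2)[of i]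
    unfolding is_uevent_def by (metis (no_types, lifting) case_prodD)
  moreover have "vals (ev i) \<in> assigns N"
    using typed dec_uevent_correct(1)[OF assms]
    by (auto simp: dec_event_def Let_def assigns_def enc_typed_def set_ulist)
  ultimately show ?thesis by (simp add: events_def)
qed

lemma theta_dec_event:
  assumes "i \<in> {1..card U}"
  shows "theta U (ev i) = (1 - conf (u i)) + (1 - snd (dec_entry E \<nu> i))" "0 \<le> theta U (ev i)"
  using theta_eq[of "u i" "ev i" "snd (dec_entry E \<nu> i)"] dec_uevent_correct[OF assms]
    dec_entry_labs[OF assms] eid_lab_dec_event[of i] by auto

section \<open>The decoded run\<close>

text \<open>Marking variables are integers, while markings of the net are natural numbers.
  Nonnegativity is therefore assumed before the step and proved after it, so that it can be carried
  along the run.\<close>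

lemma dec_firing_step:
  assumes i: "i \<in> {1..n}"
    and nonneg: "\<forall>p \<in> places N. 0 \<le> vM \<nu> (i - 1) p"
  shows "step N (\<lambda>p \<in> places N. nat (vM \<nu> (i - 1) p), \<lambda>v \<in> pvars N. vX \<nu> (i - 1) v) (fi i)
      (\<lambda>p \<in> places N. nat (vM \<nu> i p), \<lambda>v \<in> pvars N. vX \<nu> i v)"
    and "\<forall>p \<in> places N. 0 \<le> vM \<nu> i p"
proof -
  define t where "t = tlist E ! (nat (vS \<nu> i) - 1)"
  have S: "1 \<le> vS \<nu> i" "vS \<nu> i \<le> int (card (transitions N))"
    using run i by (auto simp: phi_run_def)
  then have t: "t \<in> transitions N"
    using nth_mem[of "nat (vS \<nu> i) - 1" "tlist E"] length_tlist set_tlist by (simp add: t_def)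
  have j: "nat (vS \<nu> i) \<in> {1..card (transitions N)}" "vS \<nu> i = int (nat (vS \<nu> i))" using S by auto
  then have c: "(\<forall>p \<in> {p \<in> places N. pre N p t > 0}. vM \<nu> (i - 1) p \<ge> int (pre N p t)) \<and>
           (\<forall>p \<in> places N. vM \<nu> i p - vM \<nu> (i - 1) p = int (post N t p) - int (pre N p t)) \<and>
           sat (case_rw (vX \<nu> (i - 1)) (vX \<nu> i)) (guard N t) \<and>
           (\<forall>v \<in> pvars N - wrt N t. vX \<nu> (i - 1) v = vX \<nu> i v)"
    using run i unfolding phi_run_def Let_def t_def by blast
  \<comment> \<open>The encoding bounds only the places of the preset; for all others the bound is
    nonnegativity.\<close>
  have pre: "int (pre N p t) \<le> vM \<nu> (i - 1) p" if "p \<in> places N" for p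
    using c nonneg that by (cases "pre N p t = 0") auto
  have post: "vM \<nu> i p = vM \<nu> (i - 1) p - int (pre N p t) + int (post N t p)" if "p \<in> places N" for p
  proof -
    have "vM \<nu> i p - vM \<nu> (i - 1) p = int (post N t p) - int (pre N p t)" using c that by blast
    then show ?thesis by simp
  qed
  show "\<forall>p \<in> places N. 0 \<le> vM \<nu> i p"
    using pre post by (metis add_nonneg_nonneg diff_ge_0_iff_ge of_nat_0_le_iff)
  let ?\<beta> = "restrict (case_rw (vX \<nu> (i - 1)) (vX \<nu> i)) (Rd ` pvars N \<union> Wr ` pvars N)"
  have f: "fi i = (t, ?\<beta>)" by (simp add: dec_firing_def t_def)
  have sat: "sat ?\<beta> (guard N t)"
    using c guard_vars[OF t]
    by (subst sat_cong[of _ _ "case_rw (vX \<nu> (i - 1)) (vX \<nu> i)"]) (auto simp del: One_nat_def)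
  have X: "vX \<nu> k v \<in> domain_of (vty N v)" if "v \<in> pvars N" "k \<le> n" for k v
    using typed that by (auto simp: enc_typed_def)
  have "fi i \<in> firings N"
    unfolding f using t X i by (auto simp: firings_def)
  moreover have "nat (vM \<nu> i p) = nat (vM \<nu> (i - 1) p) - pre N p t + post N t p"
    "pre N p t \<le> nat (vM \<nu> (i - 1) p)" if "p \<in> places N" for p
    using pre[OF that] post[OF that] by linarith+
  ultimately show "step N (\<lambda>p \<in> places N. nat (vM \<nu> (i - 1) p), \<lambda>v \<in> pvars N. vX \<nu> (i - 1) v) (fi i)
      (\<lambda>p \<in> places N. nat (vM \<nu> i p), \<lambda>v \<in> pvars N. vX \<nu> i v)"
    using sat c X i unfolding f step_def by (auto simp: markings_def assigns_def)
qed

lemma marking_nonneg: "i \<le> n \<Longrightarrow> \<forall>p \<in> places N. 0 \<le> vM \<nu> i p"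
proof (induction i)
  case 0
  then show ?case using run by (auto simp: phi_run_def)
next
  case (Suc i)
  then show ?case using dec_firing_step(2)[of "Suc i"] by simp
qed

lemma dec_firing_firings: "j \<in> {1..n} \<Longrightarrow> fi j \<in> firings N"
  using step_firings[OF dec_firing_step(1)[of j]] marking_nonneg[of "j - 1"] by force

lemma firings_upto_runs: "firings_upto n \<in> runs N"
proof -
  let ?\<sigma> = "\<lambda>i. (\<lambda>p \<in> places N. nat (vM \<nu> i p), \<lambda>v \<in> pvars N. vX \<nu> i v)"
  \<comment> \<open>The constraints give agreement on places and variables only; extensionality
    turns this into equality of states.\<close>
  have "init_assign N \<in> extensional (pvars N)" "init_marking N \<in> extensional (places N)"
    "final_marking N \<in> extensional (places N)"
    using dpn by (auto simp: is_dpn_def assigns_def markings_def PiE_def)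
  then have "?\<sigma> 0 = (init_marking N, init_assign N)" "fst (?\<sigma> n) = final_marking N"
    using run by (auto simp: phi_run_def restrict_def extensional_def fun_eq_iff)
  moreover have "step N (?\<sigma> i) (firings_upto n ! i) (?\<sigma> (Suc i))" if "i < n" for i
    using dec_firing_step(1)[of "Suc i"] marking_nonneg[of i] that by (simp add: firings_upto_def del: upt_Suc)
  moreover have "length (firings_upto n) = n" by (simp add: firings_upto_def)
  ultimately show ?thesis
    unfolding runs_def mem_Collect_eq steps_iff_states
    by (intro exI[of _ "snd (?\<sigma> n)"] exI[of _ ?\<sigma>]) auto
qed

section \<open>Realization and removal cost of the decoded trace\<close>

lemma events_upto_realization: "realization N U (events_upto (card U))"
proof -
  \<comment> \<open>The kept positions in increasing order; their uncertain events and timestamps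
    are the witnesses for the realization.\<close>
  define ks where "ks = filter (\<lambda>l. \<not> vdrop \<nu> (u l)) [1..<Suc (card U)]"
  have ks: "set ks = {l \<in> {1..card U}. \<not> vdrop \<nu> (u l)}" "distinct ks" "sorted ks"
    by (auto simp: ks_def sorted_wrt_filter simp del: upt_Suc)
  have es: "events_upto (card U) = map ev ks" by (simp add: events_upto_def ks_def)
  have "set (events_upto (card U)) \<subseteq> events N"
    using dec_event_events ks by (auto simp: es)
  moreover have "distinct (map u ks)"
    using ks dec_uevent_inj by (auto simp: distinct_map intro: inj_on_subset)
  moreover have "set (map u ks) \<subseteq> U" using ks dec_uevent_correct(1) by auto
  \<comment> \<open>Timestamps increase weakly along all positions, hence along the kept
    ones.\<close>
  moreover have "sorted (map (\<lambda>l. nat (vT \<nu> (u l))) ks)"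
  proof -
    have "sorted_wrt (\<lambda>x y. nat (vT \<nu> (u x)) \<le> nat (vT \<nu> (u y))) ks"
      using ks(3) by (rule sorted_wrt_mono_rel[rotated]) (use ks(1) timestamps_sorted in \<open>auto intro!: nat_mono\<close>)
    then show ?thesis by (simp add: sorted_wrt_map)
  qed
  moreover have "{ue \<in> U. conf ue = 1} \<subseteq> set (map u ks)"
    using uevent_constraints(1) dec_uevent_image ks(1) by fastforce
  moreover have "nat (vT \<nu> (u l)) \<in> stamps (u l) \<and> eid (ev l) = uid (u l) \<and>
       (\<exists>p. (lab (ev l), p) \<in> labs (u l)) \<and>
       (\<forall>v S. uvals (u l) v = Some S \<longrightarrow> vals (ev l) v \<in> S)" if "l \<in> set ks" for l
  proof -
    have l: "l \<in> {1..card U}" using that ks by auto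
    then have U: "u l \<in> U" by (rule dec_uevent_correct)
    have "vals (ev l) v \<in> S" if "uvals (u l) v = Some S" for v S
    proof -
      have "v \<in> pvars N" using uevent[OF U] that by (auto simp: is_uevent_def)
      then show ?thesis using uevent_constraints(4)[OF U that] by (simp add: dec_event_def Let_def)
    qed
    moreover have "nat (vT \<nu> (u l)) \<in> stamps (u l)" using uevent_constraints(5)[OF U] by auto
    ultimately show ?thesis
      using dec_entry_labs[OF l] eid_lab_dec_event[of l] by metis
  qed
  ultimately show ?thesis
    unfolding realization_def es
    by (intro conjI exI[of _ "map u ks"] exI[of _ "map (\<lambda>l. nat (vT \<nu> (u l))) ks"]) auto
qed

text \<open>Since identifiers are distinct, the identifiers missing from the decoded trace belong
  exactly to the dropped events. The sum over them is extended by zeros to \<open>U\<close> and then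
  reindexed by positions.\<close>

lemma removal_cost_events_upto: "removal_cost U (events_upto (card U)) = removal_upto (card U)"
proof -
  let ?c = "\<lambda>ue. if vdrop \<nu> ue then ereal (conf ue) else 0"
  have "{ue \<in> U. uid ue \<notin> eid ` set (events_upto (card U))} = {ue \<in> U. vdrop \<nu> ue}"
  proof -
    have "set (events_upto (card U)) = ev ` {l \<in> {1..card U}. \<not> vdrop \<nu> (u l)}"
      by (auto simp: events_upto_def simp del: upt_Suc)
    then have "eid ` set (events_upto (card U)) = uid ` (u ` {l \<in> {1..card U}. \<not> vdrop \<nu> (u l)})"
      by (simp add: image_image eid_lab_dec_event)
    also have "u ` {l \<in> {1..card U}. \<not> vdrop \<nu> (u l)} = {ue \<in> U. \<not> vdrop \<nu> ue}"
    proof -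
      have "f ` {l \<in> A. \<not> P (f l)} = {x \<in> f ` A. \<not> P x}" for f :: "nat \<Rightarrow> ('id, 'a, 'v) uevent" and A P
        by blast
      from this[of u "{1..card U}" "vdrop \<nu>"] show ?thesis by (simp only: dec_uevent_image)
    qed
    finally show ?thesis using uid_inject by blast
  qed
  then have "removal_cost U (events_upto (card U)) =
      (\<Sum>ue \<in> {ue \<in> U. vdrop \<nu> ue}. if conf ue < 1 then ereal (conf ue) else \<infinity>)"
    by (simp add: removal_cost_def)
  also have "\<dots> = (\<Sum>ue \<in> {ue \<in> U. vdrop \<nu> ue}. ?c ue)"
    using uevent_constraints(1) by (intro sum.cong) auto
  also have "\<dots> = sum ?c U"
    using finite_U by (intro sum.mono_neutral_left) auto
  also have "\<dots> = removal_upto (card U)"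
    unfolding removal_upto_def
    by (subst dec_uevent_image[symmetric], subst sum.reindex[OF dec_uevent_inj]) simp
  finally show ?thesis .
qed

section \<open>Values of the encoded costs\<close>

lemma enc_theta_eq:
  assumes "i \<in> {1..card U}"
  shows "enc_theta E \<nu> i = (if vdrop \<nu> (u i) then \<infinity> else ereal (theta U (ev i)))"
  using theta_dec_event[OF assms] by (simp add: enc_theta_def Let_def)

text \<open>Strict positivity of \<open>PL\<close> matters: in the extended reals 0 times infinity
  is 0, so a free log move would remain affordable for a dropped event.\<close>

lemma enc_log_cost_eq:
  assumes "i \<in> {1..card U}"
  shows "enc_log_cost N E C \<nu> i =
    (if vdrop \<nu> (u i) then \<infinity> else move_cost C U (Some (ev i), None))"
proof -
  have "0 < PL C (ev i)" using penalty dec_event_events[OF assms] by (auto simp: is_penalty_def)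
  then show ?thesis
    by (simp add: enc_log_cost_def enc_PL_def enc_theta_eq[OF assms] one_ereal_def)
qed

lemma enc_kappa_eq:
  "enc_kappa E \<nu> i = (if vdrop \<nu> (u i) then ereal (conf (u i)) else \<infinity>)"
  by (simp add: enc_kappa_def Let_def)

lemma enc_PM_eq: "enc_PM N E C \<nu> j = move_cost C U (None, Some (fi j))"
  by (simp add: enc_PM_def)

text \<open>For a dropped event the infinite confidence term stands alone if the penalty is 0, and
  otherwise is multiplied by something positive. For a kept event the two formulas agree by
  distributivity, checked separately for real and infinite penalties.\<close>

lemma enc_sync_cost_eq:
  assumes "i \<in> {1..card U}" "j \<in> {1..n}"
  shows "enc_sync_cost N E C \<nu> i j =
    (if vdrop \<nu> (u i) then \<infinity> else move_cost C U (Some (ev i), Some (fi j)))"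
proof -
  have "0 \<le> PE C (ev i) (fi j)"
    using penalty dec_event_events[OF assms(1)] dec_firing_firings[OF assms(2)]
    by (auto simp: is_penalty_def)
  moreover have "0 \<le> theta U (ev i)" using assms theta_dec_event by blast
  ultimately show ?thesis
    by (cases "PE C (ev i) (fi j)")
      (auto simp: enc_sync_cost_def enc_PE_def enc_theta_eq[OF assms(1)] algebra_simps)
qed

lemma sync_cost_nonneg:
  assumes "i \<in> {1..card U}" "j \<in> {1..n}"
  shows "0 \<le> enc_sync_cost N E C \<nu> i j"
proof -
  have "0 \<le> PE C (ev i) (fi j)"
    using penalty dec_event_events[OF assms(1)] dec_firing_firings[OF assms(2)]
    by (auto simp: is_penalty_def)
  moreover have "0 \<le> theta U (ev i)" using assms theta_dec_event by blast
  ultimately show ?thesis by (simp add: enc_sync_cost_eq[OF assms])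
qed

lemma log_cost_nonneg:
  assumes "i \<in> {1..card U}"
  shows "0 \<le> enc_log_cost N E C \<nu> i"
proof -
  have "0 < PL C (ev i)" using penalty dec_event_events[OF assms] by (auto simp: is_penalty_def)
  then show ?thesis using theta_dec_event(2)[OF assms] by (simp add: enc_log_cost_eq[OF assms])
qed

lemma kappa_nonneg:
  assumes "i \<in> {1..card U}"
  shows "0 \<le> enc_kappa E \<nu> i"
  using uevent[OF dec_uevent_correct(1)[OF assms]] by (simp add: enc_kappa_eq is_uevent_def)

lemma PM_nonneg:
  assumes "j \<in> {1..n}"
  shows "0 \<le> enc_PM N E C \<nu> j"
  using penalty dec_firing_firings[OF assms] by (auto simp: enc_PM_def is_penalty_def)

end

section \<open>Existence of real-valued distances\<close>

fun edit_distance ::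
  "(nat \<Rightarrow> ereal) \<Rightarrow> (nat \<Rightarrow> ereal) \<Rightarrow> (nat \<Rightarrow> ereal) \<Rightarrow> (nat \<Rightarrow> nat \<Rightarrow> ereal) \<Rightarrow> nat \<Rightarrow> nat \<Rightarrow> ereal"
where
  "edit_distance L K M S 0 0 = 0"
| "edit_distance L K M S 0 (Suc j) = M (Suc j) + edit_distance L K M S 0 j"
| "edit_distance L K M S (Suc i) 0 = min (L (Suc i)) (K (Suc i)) + edit_distance L K M S i 0"
| "edit_distance L K M S (Suc i) (Suc j) =
     Min {S (Suc i) (Suc j) + edit_distance L K M S i j,
          L (Suc i) + edit_distance L K M S i (Suc j),
          K (Suc i) + edit_distance L K M S i (Suc j),
          M (Suc j) + edit_distance L K M S (Suc i) j}"

text \<open>Synchronous costs may be infinite, but a finite path always exists: treat the first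
  \<open>i\<close> events by the cheaper of log move and removal, then perform \<open>j\<close>
  model moves. Correspondingly, column 0 uses the bound on the minimum and every later column is
  reached from its left neighbour.\<close>

lemma edit_distance_finite:
  assumes "\<And>i. i \<in> {1..m} \<Longrightarrow> 0 \<le> L i \<and> 0 \<le> K i \<and> min (L i) (K i) \<noteq> \<infinity>"
    and "\<And>j. j \<in> {1..n} \<Longrightarrow> 0 \<le> M j \<and> M j \<noteq> \<infinity>"
    and "\<And>i j. i \<in> {1..m} \<Longrightarrow> j \<in> {1..n} \<Longrightarrow> 0 \<le> S i j"
    and "i \<le> m" "j \<le> n"
  shows "0 \<le> edit_distance L K M S i j \<and> edit_distance L K M S i j \<noteq> \<infinity>"
  using assms(4,5)
proof (induction i arbitrary: j)
  case 0
  then show ?case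
  proof (induction j)
    case (Suc j)
    then show ?case using assms(2)[of "Suc j"] by simp
  qed simp
next
  case (Suc i)
  note IH = Suc.IH
  from Suc.prems show ?case
  proof (induction j)
    case 0
    then show ?case using assms(1)[of "Suc i"] IH[of 0] by (auto simp: min_def)
  next
    case (Suc j)
    then have M: "0 \<le> M (Suc j) + edit_distance L K M S (Suc i) j"
      "M (Suc j) + edit_distance L K M S (Suc i) j \<noteq> \<infinity>"
      using assms(2)[of "Suc j"] by auto
    have "edit_distance L K M S (Suc i) (Suc j) \<le> M (Suc j) + edit_distance L K M S (Suc i) j"
      by (simp del: Min_insert)
    then have "edit_distance L K M S (Suc i) (Suc j) \<noteq> \<infinity>" using M(2) by auto
    moreover have "0 \<le> edit_distance L K M S (Suc i) (Suc j)"
      using assms(1)[of "Suc i"] assms(3)[of "Suc i" "Suc j"] M(1) IH[of j] IH[of "Suc j"] Suc.prems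
      by simp
    ultimately show ?case by blast
  qed
qed

context decoded
begin

text \<open>The edit distance solves the recursion in the extended reals, and being finite it can be
  stored in the real variables \<open>vd\<close>.\<close>

lemma phi_delta_exists: "\<exists>g. phi_delta N E C n (\<nu>\<lparr>vd := g\<rparr>)"
proof -
  define D where "D = edit_distance (enc_log_cost N E C \<nu>) (enc_kappa E \<nu>) (enc_PM N E C \<nu>)
    (enc_sync_cost N E C \<nu>)"
  \<comment> \<open>A dropped event has finite removal cost, a kept one finite log cost.\<close>
  have "min (enc_log_cost N E C \<nu> i) (enc_kappa E \<nu> i) \<noteq> \<infinity>" if "i \<in> {1..card U}" for i
    by (simp add: enc_log_cost_eq[OF that] enc_kappa_eq min_def)
  then have fin: "0 \<le> D i j \<and> D i j \<noteq> \<infinity>" if "i \<le> card U" "j \<le> n" for i j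
    unfolding D_def using that log_cost_nonneg kappa_nonneg PM_nonneg sync_cost_nonneg
    by (intro edit_distance_finite) (auto simp: enc_PM_def)
  have D: "ereal (real_of_ereal (D i j)) = D i j" if "i \<le> card U" "j \<le> n" for i j
    using fin[OF that] by (auto simp: ereal_real')
  \<comment> \<open>No cost expression reads \<open>vd\<close>, so overwriting it leaves the
    recursion's coefficients intact.\<close>
  have unaffected:
    "enc_log_cost N E C (\<nu>\<lparr>vd := g\<rparr>) = enc_log_cost N E C \<nu>"
    "enc_kappa E (\<nu>\<lparr>vd := g\<rparr>) = enc_kappa E \<nu>"
    "enc_PM N E C (\<nu>\<lparr>vd := g\<rparr>) = enc_PM N E C \<nu>"
    "enc_sync_cost N E C (\<nu>\<lparr>vd := g\<rparr>) = enc_sync_cost N E C \<nu>" for g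
    by (simp_all add: fun_eq_iff enc_log_cost_def enc_kappa_def enc_PM_def enc_sync_cost_def
        enc_PL_def enc_PE_def enc_theta_def dec_event_def dec_entry_def dec_uevent_def
        dec_firing_def Let_def)
  have "D i 0 = min (enc_log_cost N E C \<nu> i) (enc_kappa E \<nu> i) + D (i - 1) 0"
    if "i \<in> {1..card U}" for i
    using that by (cases i) (auto simp: D_def)
  moreover have "D 0 j = enc_PM N E C \<nu> j + D 0 (j - 1)" if "j \<in> {1..n}" for j
    using that by (cases j) (auto simp: D_def)
  moreover have "D i j =
           Min {enc_sync_cost N E C \<nu> i j + D (i - 1) (j - 1),
                enc_log_cost N E C \<nu> i + D (i - 1) j,
                enc_kappa E \<nu> i + D (i - 1) j,
                enc_PM N E C \<nu> j + D i (j - 1)}" if "i \<in> {1..card U}" "j \<in> {1..n}" for i j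
    using that by (cases i; cases j) (simp_all add: D_def del: Min_insert)
  moreover have "D 0 0 = 0" by (simp add: D_def)
  ultimately have recursion: "D 0 0 = 0 \<and>
        (\<forall>i \<in> {1..card U}. D i 0 = min (enc_log_cost N E C \<nu> i) (enc_kappa E \<nu> i) + D (i - 1) 0) \<and>
        (\<forall>j \<in> {1..n}. D 0 j = enc_PM N E C \<nu> j + D 0 (j - 1)) \<and>
        (\<forall>i \<in> {1..card U}. \<forall>j \<in> {1..n}. D i j =
           Min {enc_sync_cost N E C \<nu> i j + D (i - 1) (j - 1),
                enc_log_cost N E C \<nu> i + D (i - 1) j,
                enc_kappa E \<nu> i + D (i - 1) j,
                enc_PM N E C \<nu> j + D i (j - 1)})"
    by blast
  have "phi_delta N E C n (\<nu>\<lparr>vd := \<lambda>i j. real_of_ereal (D i j)\<rparr>)"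
    unfolding phi_delta_def Let_def unaffected length_ulist
    by (simp add: D le_trans[OF diff_le_self] del: Min_insert One_nat_def) (use recursion in blast)
  then show ?thesis by blast
qed

end

section \<open>The distance as cost of the decoded alignment and as lower bound\<close>

locale weighted = decoded +
  assumes delta: "phi_delta N E C n \<nu>"
begin

abbreviation "d \<equiv> \<lambda>i j. ereal (vd \<nu> i j)"

lemma d_0_0: "d 0 0 = 0"
  using delta by (simp add: phi_delta_def Let_def)

lemma d_Suc_0:
  "i < card U \<Longrightarrow>
    d (Suc i) 0 = min (enc_log_cost N E C \<nu> (Suc i)) (enc_kappa E \<nu> (Suc i)) + d i 0"
  using delta by (force simp: phi_delta_def Let_def length_ulist)

lemma d_0_Suc: "j < n \<Longrightarrow> d 0 (Suc j) = enc_PM N E C \<nu> (Suc j) + d 0 j"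
  using delta by (force simp: phi_delta_def Let_def)

lemma d_Suc_Suc:
  assumes "i < card U" "j < n"
  shows "d (Suc i) (Suc j) =
     Min {enc_sync_cost N E C \<nu> (Suc i) (Suc j) + d i j,
          enc_log_cost N E C \<nu> (Suc i) + d i (Suc j),
          enc_kappa E \<nu> (Suc i) + d i (Suc j),
          enc_PM N E C \<nu> (Suc j) + d (Suc i) j}"
proof -
  have "\<forall>i \<in> {1..card U}. \<forall>j \<in> {1..n}. d i j =
           Min {enc_sync_cost N E C \<nu> i j + d (i - 1) (j - 1),
                enc_log_cost N E C \<nu> i + d (i - 1) j,
                enc_kappa E \<nu> i + d (i - 1) j,
                enc_PM N E C \<nu> j + d i (j - 1)}"
    using delta unfolding phi_delta_def Let_def length_ulist by blast
  from this[rule_format, of "Suc i" "Suc j"] show ?thesis using assms by simp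
qed

text \<open>Column 0 obeys a separate equation with two alternatives only; the case split on
  \<open>j\<close> lets later arguments treat all columns alike.\<close>

lemma d_le:
  assumes "i < card U" "j \<le> n"
  shows "d (Suc i) j \<le> enc_kappa E \<nu> (Suc i) + d i j"
    and "d (Suc i) j \<le> enc_log_cost N E C \<nu> (Suc i) + d i j"
  using assms by (cases j; simp add: d_Suc_0 d_Suc_Suc add_right_mono min.coboundedI1 min.coboundedI2)+

lemma d_le_model:
  assumes "i \<le> card U" "j < n"
  shows "d i (Suc j) \<le> enc_PM N E C \<nu> (Suc j) + d i j"
  using assms by (cases i) (simp_all add: d_0_Suc d_Suc_Suc min.coboundedI2)

lemma d_le_sync:
  assumes "i < card U" "j < n"
  shows "d (Suc i) (Suc j) \<le> enc_sync_cost N E C \<nu> (Suc i) (Suc j) + d i j"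
  using assms by (simp add: d_Suc_Suc)

text \<open>Each branch of \<open>decode\<close> follows an alternative that attains the minimum. As
  \<open>d i j\<close> is real, no infinite alternative is ever followed: a log or synchronous move
  is emitted only for a kept event, and a removal occurs only for a dropped one. Hence projections
  and cost grow in step with the prefixes.\<close>

lemma decode_correct:
  assumes "i \<le> card U" "j \<le> n"
  shows "projL (decode N E C \<nu> i j) = events_upto i \<and>
    projM (decode N E C \<nu> i j) = firings_upto j \<and>
    set (decode N E C \<nu> i j) \<subseteq> moves N \<and>
    d i j = alignment_cost C U (decode N E C \<nu> i j) + removal_upto i"
  using assms
proof (induction i arbitrary: j)
  case 0
  then show ?case
  proof (induction j)
    case (Suc j)
    then show ?case
      using dec_firing_firings[of "Suc j"]
      by (simp add: d_0_Suc enc_PM_eq add.commute moves_def)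
  qed (simp add: d_0_0)
next
  case (Suc i)
  note IH = Suc.IH
  have i: "Suc i \<in> {1..card U}" using Suc.prems by simp
  note log = enc_log_cost_eq[OF i] and ev = dec_event_events[OF i]
  from Suc.prems show ?case
  proof (induction j)
    case 0
    show ?case
    proof (cases "vdrop \<nu> (u (Suc i))")
      case True
      then have "d (Suc i) 0 \<noteq> enc_log_cost N E C \<nu> (Suc i) + d i 0" using log by simp
      then have "decode N E C \<nu> (Suc i) 0 = decode N E C \<nu> i 0" by simp
      then show ?thesis
        using True IH[of 0] i by (simp add: d_Suc_0 log enc_kappa_eq ac_simps del: decode.simps)
    next
      case False
      then show ?thesis
        using IH[of 0] i ev by (simp add: d_Suc_0 log enc_kappa_eq ac_simps moves_def)
    qed
  next
    case (Suc j)
    have j: "Suc j \<in> {1..n}" using Suc.prems by simp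
    note fi = dec_firing_firings[OF j]
    note sync = enc_sync_cost_eq[OF i j]
    let ?l = "enc_log_cost N E C \<nu> (Suc i) + d i (Suc j)"
    let ?k = "enc_kappa E \<nu> (Suc i) + d i (Suc j)"
    let ?m = "enc_PM N E C \<nu> (Suc j) + d (Suc i) j"
    let ?s = "enc_sync_cost N E C \<nu> (Suc i) (Suc j) + d i j"
    \<comment> \<open>The cases repeat the order of priority in \<open>decode\<close>.\<close>
    consider "d (Suc i) (Suc j) = ?l" | "d (Suc i) (Suc j) \<noteq> ?l" "d (Suc i) (Suc j) = ?k"
      | "d (Suc i) (Suc j) \<noteq> ?l" "d (Suc i) (Suc j) \<noteq> ?k" "d (Suc i) (Suc j) = ?m"
      | "d (Suc i) (Suc j) \<noteq> ?l" "d (Suc i) (Suc j) \<noteq> ?k" "d (Suc i) (Suc j) \<noteq> ?m"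
      by blast
    then show ?case
    proof cases
      case 1
      \<comment> \<open>For a dropped event \<open>?l\<close> would be infinite.\<close>
      then have kept: "\<not> vdrop \<nu> (u (Suc i))" using log by auto
      have dec: "decode N E C \<nu> (Suc i) (Suc j) =
          decode N E C \<nu> i (Suc j) @ [(Some (ev (Suc i)), None)]"
        using 1 by simp
      then have "d (Suc i) (Suc j) =
          alignment_cost C U (decode N E C \<nu> (Suc i) (Suc j)) + removal_upto (Suc i)"
        using 1 IH[of "Suc j"] i j log kept
        by (simp add: ac_simps del: decode.simps move_cost.simps)
      then show ?thesis
        using dec IH[of "Suc j"] i j ev kept by (simp add: moves_def del: decode.simps)
    next
      case 2
      then have "vdrop \<nu> (u (Suc i))" using enc_kappa_eq[of "Suc i"] by (auto split: if_splits)
      moreover have "decode N E C \<nu> (Suc i) (Suc j) = decode N E C \<nu> i (Suc j)"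
        using 2 by simp
      ultimately show ?thesis
        using 2(2) IH[of "Suc j"] i j
        by (simp add: enc_kappa_eq ac_simps del: decode.simps plus_ereal.simps)
    next
      case 3
      then have "decode N E C \<nu> (Suc i) (Suc j) =
          decode N E C \<nu> (Suc i) j @ [(None, Some (fi (Suc j)))]" by simp
      \<comment> \<open>Only a model move stays in the same row, so this is the inner induction
        hypothesis.\<close>
      moreover have "projL (decode N E C \<nu> (Suc i) j) = events_upto (Suc i) \<and>
          projM (decode N E C \<nu> (Suc i) j) = firings_upto j \<and>
          set (decode N E C \<nu> (Suc i) j) \<subseteq> moves N \<and>
          d (Suc i) j = alignment_cost C U (decode N E C \<nu> (Suc i) j) + removal_upto (Suc i)"
        using Suc by simp
      ultimately show ?thesis
        using 3 fi
        by (simp add: enc_PM_eq ac_simps moves_def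
            del: decode.simps events_upto_simps removal_upto_simps)
    next
      case 4
      \<comment> \<open>A finite minimum is attained, so excluding three alternatives leaves the
        synchronous one.\<close>
      have "d (Suc i) (Suc j) \<in> {?s, ?l, ?k, ?m}"
        using d_Suc_Suc[of i j] i j Min_in[of "{?s, ?l, ?k, ?m}"] by simp
      then have s: "d (Suc i) (Suc j) = ?s" using 4 by blast
      then have kept: "\<not> vdrop \<nu> (u (Suc i))" using sync by auto
      have dec: "decode N E C \<nu> (Suc i) (Suc j) =
          decode N E C \<nu> i j @ [(Some (ev (Suc i)), Some (fi (Suc j)))]"
        using 4 by simp
      then have "d (Suc i) (Suc j) =
          alignment_cost C U (decode N E C \<nu> (Suc i) (Suc j)) + removal_upto (Suc i)"
        using s IH[of j] i j sync kept
        by (simp add: ac_simps del: decode.simps move_cost.simps)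
      then show ?thesis
        using dec IH[of j] i j ev fi kept by (simp add: moves_def del: decode.simps)
    qed
  qed
qed

text \<open>Either the last event is dropped, and \<open>i\<close> decreases while
  \<open>\<gamma>\<close> stays, or the last move of \<open>\<gamma>\<close> is removed;
  \<open>length \<gamma> + i\<close> decreases in both cases. Each reduction is paid for by one
  alternative of the recursion.\<close>

lemma d_lower_bound:
  assumes "i \<le> card U" "j \<le> n" "projL \<gamma> = events_upto i" "projM \<gamma> = firings_upto j"
  shows "d i j \<le> alignment_cost C U \<gamma> + removal_upto i"
  using assms
proof (induction "length \<gamma> + i" arbitrary: \<gamma> i j rule: less_induct)
  case less
  show ?case
  \<comment> \<open>A dropped event leaves no trace in \<open>\<gamma>\<close>, so it is handled
    before any move is inspected. Position 0 carries no event.\<close>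
  proof (cases "i > 0 \<and> vdrop \<nu> (u i)")
    case True
    then obtain k where k: "i = Suc k" "vdrop \<nu> (u (Suc k))" by (cases i) auto
    then have "d k j \<le> alignment_cost C U \<gamma> + removal_upto k"
      using less by simp
    then have "enc_kappa E \<nu> (Suc k) + d k j \<le> alignment_cost C U \<gamma> + removal_upto i"
      using add_cost_le(1)[of "d k j" _ _ "enc_kappa E \<nu> (Suc k)"] k by (simp add: enc_kappa_eq)
    then show ?thesis
      using d_le(1)[of k j] less.prems k by simp
  next
    case kept: False
    show ?thesis
    proof (cases \<gamma> rule: rev_cases)
      case Nil
      have "i = 0" using kept less.prems(3) Nil by (cases i) auto
      moreover have "j = 0" using less.prems(4) Nil by (cases j) auto
      ultimately show ?thesis using Nil d_0_0 by simp
    next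
      case (snoc \<delta> mv)
      note IH = less.hyps[of \<delta>]
      show ?thesis
      proof (cases mv)
        case (Pair e f)
        show ?thesis
        proof (cases e)
          case None
          show ?thesis
          proof (cases f)
            case None
            \<comment> \<open>Nothing in the hypotheses excludes a pair of two skips; it costs 0 and
              leaves both projections unchanged.\<close>
            then show ?thesis using IH[of i j] less.prems snoc Pair \<open>e = None\<close>
              by (simp add: projL_def projM_def List.map_filter_def)
          next
            case (Some g)
            then obtain l where l: "j = Suc l"
              using less.prems(4) snoc Pair by (cases j) auto
            then have g: "g = fi (Suc l)" "projM \<delta> = firings_upto l" "projL \<delta> = events_upto i"
              using less.prems(3,4) snoc Pair Some \<open>e = None\<close> by auto
            then have "d i l \<le> alignment_cost C U \<delta> + removal_upto i"
              using IH[of i l] less.prems l snoc by simp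
            then have "enc_PM N E C \<nu> (Suc l) + d i l \<le> alignment_cost C U \<gamma> + removal_upto i"
              using add_cost_le(2)[of "d i l" _ _ "enc_PM N E C \<nu> (Suc l)"] snoc Pair Some g \<open>e = None\<close>
              by (simp add: enc_PM_eq)
            then show ?thesis using d_le_model[of i l] less.prems l by simp
          qed
        next
          case (Some a)
          then obtain k where k: "i = Suc k"
            using less.prems(3) snoc Pair by (cases i) auto
          \<comment> \<open>Because the event at \<open>Suc k\<close> is kept, it is the last one of
            the prefix and must be the one in the last move.\<close>
          have a: "\<not> vdrop \<nu> (u (Suc k))" "a = ev (Suc k)" "projL \<delta> = events_upto k"
            using less.prems(3) snoc Pair Some kept k by auto
          have ki: "Suc k \<in> {1..card U}" using k less.prems by simp
          show ?thesis
          proof (cases f)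
            case None
            then have "d k j \<le> alignment_cost C U \<delta> + removal_upto k"
              using IH[of k j] less.prems k snoc a Pair by simp
            then have "enc_log_cost N E C \<nu> (Suc k) + d k j \<le> alignment_cost C U \<gamma> + removal_upto i"
              using add_cost_le(2)[of "d k j" _ _ "enc_log_cost N E C \<nu> (Suc k)"]
                snoc Pair Some None a k enc_log_cost_eq[OF ki]
              by (simp del: move_cost.simps)
            then show ?thesis using d_le(2)[of k j] less.prems k by simp
          next
            case (Some g)
            then obtain l where l: "j = Suc l"
              using less.prems(4) snoc Pair by (cases j) auto
            then have g: "g = fi (Suc l)" "projM \<delta> = firings_upto l"
              using less.prems(4) snoc Pair Some by auto
            have lj: "Suc l \<in> {1..n}" using l less.prems by simp
            have "d k l \<le> alignment_cost C U \<delta> + removal_upto k"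
              using IH[of k l] less.prems k l snoc a g by simp
            then have "enc_sync_cost N E C \<nu> (Suc k) (Suc l) + d k l \<le>
                alignment_cost C U \<gamma> + removal_upto i"
              using add_cost_le(2)[of "d k l" _ _ "enc_sync_cost N E C \<nu> (Suc k) (Suc l)"]
                snoc Pair Some \<open>e = Some a\<close> a g k enc_sync_cost_eq[OF ki lj]
              by (simp del: move_cost.simps)
            then show ?thesis using d_le_sync[of k l] less.prems k l by simp
          qed
        qed
      qed
    qed
  qed
qed

lemma decode_alignment:
  "alignment N (events_upto (card U)) (decode N E C \<nu> (card U) n)"
  "total_cost C U (decode N E C \<nu> (card U) n) = d (card U) n"
  using decode_correct[of "card U" n] firings_upto_runs
  by (simp_all add: alignment_def total_cost_def removal_cost_events_upto)

lemma total_cost_lower_bound: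
  assumes "projL \<gamma> = events_upto (card U)" "projM \<gamma> = firings_upto n"
  shows "d (card U) n \<le> total_cost C U \<gamma>"
  using d_lower_bound[OF _ _ assms] assms by (simp add: total_cost_def removal_cost_events_upto)

end

section \<open>Encoding an alignment\<close>

context uncertain_trace
begin

text \<open>The statement fixes three components and quantifies over all assignments having them, so
  that the result can be merged with an independent choice of the trace components and of
  \<open>vd\<close>.\<close>

lemma run_encodable:
  assumes run: "steps N (init_marking N, init_assign N) fs (final_marking N, \<alpha>F)"
  shows "\<exists>S M X. \<forall>\<nu> :: ('id, 'p, 'a, 'v) enc. vS \<nu> = S \<and> vM \<nu> = M \<and> vX \<nu> = X \<longrightarrow>
    phi_run N E (length fs) \<nu> \<and>
    (\<forall>v \<in> pvars N. \<forall>i \<le> length fs. vX \<nu> i v \<in> domain_of (vty N v)) \<and>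
    map (dec_firing N E \<nu>) [1..<Suc (length fs)] = fs"
proof -
  obtain \<sigma> where \<sigma>: "\<sigma> 0 = (init_marking N, init_assign N)" "\<sigma> (length fs) = (final_marking N, \<alpha>F)"
    and st: "\<And>i. i < length fs \<Longrightarrow> step N (\<sigma> i) (fs ! i) (\<sigma> (Suc i))"
    using run unfolding steps_iff_states by blast
  obtain pos where pos: "\<And>k. k < length (tlist E) \<Longrightarrow> pos (tlist E ! k) = k"
    "\<And>t. t \<in> set (tlist E) \<Longrightarrow> pos t < length (tlist E) \<and> tlist E ! pos t = t"
    using distinct_position[OF distinct_tlist] by metis
  \<comment> \<open>Transition numbers and time steps start at 1, list indices at 0.\<close>
  define S where "S i = int (Suc (pos (fst (fs ! (i - 1)))))" for i
  define M where "M i p = int (fst (\<sigma> i) p)" for i p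
  define X where "X i v = snd (\<sigma> i) v" for i v
  have assigns: "snd (\<sigma> i) \<in> assigns N" if "i \<le> length fs" for i
  proof (cases i)
    case 0
    then show ?thesis using dpn \<sigma> by (simp add: is_dpn_def)
  next
    case (Suc k)
    then show ?thesis using st[of k] step_assigns that by (metis Suc_le_lessD)
  qed
  have tr: "fst (fs ! k) \<in> transitions N" if "k < length fs" for k
    using step_firings[OF st[OF that]] by (auto simp: firings_def)
  have "phi_run N E (length fs) \<nu> \<and>
    (\<forall>v \<in> pvars N. \<forall>i \<le> length fs. vX \<nu> i v \<in> domain_of (vty N v)) \<and>
    map (dec_firing N E \<nu>) [1..<Suc (length fs)] = fs"
    if "vS \<nu> = S \<and> vM \<nu> = M \<and> vX \<nu> = X" for \<nu> :: "('id, 'p, 'a, 'v) enc"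
  proof -
    have \<nu>: "vS \<nu> = S" "vM \<nu> = M" "vX \<nu> = X" using that by auto
    have t: "nat (S (Suc k)) - 1 = pos (fst (fs ! k))"
      "tlist E ! (nat (S (Suc k)) - 1) = fst (fs ! k)" "pos (fst (fs ! k)) < card (transitions N)"
      if "k < length fs" for k
      using pos(2)[of "fst (fs ! k)"] tr[OF that] set_tlist length_tlist
      by (auto simp: S_def simp del: of_nat_Suc)
    have f: "dec_firing N E \<nu> (Suc k) = fs ! k" and
      sat: "sat (case_rw (X k) (X (Suc k))) (guard N (fst (fs ! k)))" if k: "k < length fs" for k
    proof -
      obtain t \<beta> where tb: "fs ! k = (t, \<beta>)" by force
      have s: "step N (fst (\<sigma> k), snd (\<sigma> k)) (t, \<beta>) (fst (\<sigma> (Suc k)), snd (\<sigma> (Suc k)))"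
        using st[OF k] tb by simp
      then have \<beta>: "\<beta> \<in> extensional (Rd ` pvars N \<union> Wr ` pvars N)"
        "\<forall>v \<in> pvars N. \<beta> (Rd v) = X k v \<and> \<beta> (Wr v) = X (Suc k) v"
        by (auto simp: step_def firings_def X_def PiE_iff)
      \<comment> \<open>A firing's assignment is extensional, hence determined by the states before
        and after it.\<close>
      then have "restrict (case_rw (X k) (X (Suc k))) (Rd ` pvars N \<union> Wr ` pvars N) = \<beta>"
        by (intro extensionalityI[of _ "Rd ` pvars N \<union> Wr ` pvars N"]) auto
      then show "dec_firing N E \<nu> (Suc k) = fs ! k"
        using t[OF k] tb by (simp add: dec_firing_def \<nu>)
      have "sat (case_rw (X k) (X (Suc k))) (guard N t) = sat \<beta> (guard N t)"
        using \<beta>(2) guard_vars[of t] tr[OF k] tb by (intro sat_cong) fastforce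
      then show "sat (case_rw (X k) (X (Suc k))) (guard N (fst (fs ! k)))"
        using s tb by (auto simp: step_def)
    qed
    have "map (dec_firing N E \<nu>) [1..<Suc (length fs)] = fs"
      by (rule nth_equalityI) (simp_all add: f del: upt_Suc)
    moreover have "\<forall>v \<in> pvars N. \<forall>i \<le> length fs. vX \<nu> i v \<in> domain_of (vty N v)"
      using assigns by (auto simp: \<nu> X_def assigns_def)
    moreover have "phi_run N E (length fs) \<nu>"
    proof -
      have "\<forall>p \<in> places N. M 0 p = int (init_marking N p) \<and> M (length fs) p = int (final_marking N p)"
        "\<forall>v \<in> pvars N. X 0 v = init_assign N v" by (auto simp: M_def X_def \<sigma>)
      moreover have "1 \<le> S i \<and> S i \<le> int (card (transitions N))" if i: "i \<in> {1..length fs}" for i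
        using t(3)[of "i - 1"] i by (force simp: S_def)
      moreover have "(\<forall>p \<in> {p \<in> places N. pre N p t > 0}. M (i - 1) p \<ge> int (pre N p t)) \<and>
           (\<forall>p \<in> places N. M i p - M (i - 1) p = int (post N t p) - int (pre N p t)) \<and>
           sat (case_rw (X (i - 1)) (X i)) (guard N t) \<and>
           (\<forall>v \<in> pvars N - wrt N t. X (i - 1) v = X i v)"
        if i: "i \<in> {1..length fs}" and j: "S i = int j" and t_def: "t = tlist E ! (j - 1)" for i j t
      proof -
        obtain k where k: "i = Suc k" "k < length fs" using i by (cases i) auto
        then have tk: "t = fst (fs ! k)" using t(2)[of k] j t_def by simp
        obtain \<beta> where "fs ! k = (t, \<beta>)" using tk by (metis prod.collapse)
        then have s: "step N (fst (\<sigma> k), snd (\<sigma> k)) (t, \<beta>) (fst (\<sigma> (Suc k)), snd (\<sigma> (Suc k)))"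
          using st[OF k(2)] by simp
        then show ?thesis
          using sat[OF k(2)] tk by (auto simp: k step_def M_def X_def)
      qed
      ultimately show ?thesis unfolding phi_run_def Let_def \<nu> by blast
    qed
    ultimately show ?thesis by blast
  qed
  then show ?thesis by blast
qed

section \<open>Encoding a realization\<close>

lemma uvals_admissible:
  assumes "ue \<in> U" "uvals ue v = Some S"
  shows "S \<noteq> {}" "S \<subseteq> domain_of (vty N v)"
proof -
  have "finite S \<and> S \<noteq> {} \<and> S \<subseteq> domain_of (vty N v) \<or>
        vty N v = TInt \<and> (\<exists>l u. l \<le> u \<and> S = IntV ` {l..u}) \<or>
        vty N v = TRat \<and> (\<exists>l u. l \<le> u \<and> S = RatV ` {l..u})"
    using uevent[OF assms(1)] assms(2) unfolding is_uevent_def by blast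
  then show "S \<noteq> {}" "S \<subseteq> domain_of (vty N v)" by auto
qed

lemma domain_of_nonempty: "domain_of ty \<noteq> {}"
  by (cases ty) auto

lemma stamps_nonempty: "ue \<in> U \<Longrightarrow> stamps ue \<noteq> {}"
  using uevent[of ue] by (auto simp: is_uevent_def)

text \<open>Events of the realization keep their timestamps, labels and values; the omitted ones are
  marked as dropped but still need admissible data and a position. Sorting everything by timestamp
  provides the positions.\<close>

lemma trace_encodable:
  assumes real: "realization N U es"
  shows "\<exists>dr A T P D L. \<forall>\<nu> :: ('id, 'p, 'a, 'v) enc.
    vdrop \<nu> = dr \<and> vA \<nu> = A \<and> vT \<nu> = T \<and> vP \<nu> = P \<and> vD \<nu> = D \<and> vL \<nu> = L \<longrightarrow>
    phi_trace E \<nu> \<and>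
    (\<forall>v \<in> pvars N. \<forall>ue \<in> U. vD \<nu> v ue \<in> domain_of (vty N v)) \<and>
    map (dec_event N E \<nu>) (filter (\<lambda>i. \<not> vdrop \<nu> (dec_uevent E \<nu> i)) [1..<Suc (card U)]) = es"
proof -
  obtain ues taus where len: "length ues = length es" "length taus = length es"
    and ues: "distinct ues" "set ues \<subseteq> U" and taus: "sorted taus"
    and adm: "\<And>i. i < length es \<Longrightarrow>
           taus ! i \<in> stamps (ues ! i) \<and>
           eid (es ! i) = uid (ues ! i) \<and>
           (\<exists>p. (lab (es ! i), p) \<in> labs (ues ! i)) \<and>
           (\<forall>v S. uvals (ues ! i) v = Some S \<longrightarrow> vals (es ! i) v \<in> S)"
    and certain: "{ue \<in> U. conf ue = 1} \<subseteq> set ues"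
    and es: "set es \<subseteq> events N"
    using real unfolding realization_def by blast
  obtain pos where pos: "\<And>k. k < length ues \<Longrightarrow> pos (ues ! k) = k"
    "\<And>ue. ue \<in> set ues \<Longrightarrow> pos ue < length ues \<and> ues ! pos ue = ue"
    using distinct_position[OF ues(1)] by metis
  \<comment> \<open>The event realizing \<open>ue\<close>, meaningful only for members of
    \<open>ues\<close>.\<close>
  define ev where "ev ue = es ! pos ue" for ue
  have map_ev: "map ev ues = es"
    by (rule nth_equalityI) (simp_all add: len ev_def pos)
  have ev: "ev ue \<in> events N" "eid (ev ue) = uid ue" "\<exists>p. (lab (ev ue), p) \<in> labs ue"
    "\<And>v S. uvals ue v = Some S \<Longrightarrow> vals (ev ue) v \<in> S" "taus ! pos ue \<in> stamps ue"
    if "ue \<in> set ues" for ue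
    using adm[of "pos ue"] pos(2)[OF that] es len by (auto simp: ev_def)
  define T where "T ue = (if ue \<in> set ues then taus ! pos ue else (SOME t. t \<in> stamps ue))" for ue
  have T: "T ue \<in> stamps ue" if "ue \<in> U" for ue
    using ev(5) stamps_nonempty[OF that] by (auto simp: T_def some_in_eq)
  obtain rest where rest: "set rest = U - set ues" "distinct rest"
    using finite_distinct_list[of "U - set ues"] finite_U by auto
  \<comment> \<open>Removed events may have to be placed between the kept ones; since sorting is stable, the kept
    ones stay in the order of the realization even when their timestamps coincide.\<close>
  define us where "us = sort_key T (ues @ rest)"
  have us: "distinct us" "set us = U" "sorted (map T us)"
    using rest ues by (auto simp: us_def)
  then have length_us: "length us = card U" using distinct_card by fastforce
  have "map T ues = taus"
    by (rule nth_equalityI) (simp_all add: len T_def pos)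
  then have "sort_key T ues = ues" using taus by (simp add: sort_key_id_if_sorted)
  moreover have "filter (\<lambda>ue. ue \<in> set ues) rest = []" using rest by (auto simp: filter_empty_conv)
  \<comment> \<open>Filtering commutes with the stable sort, and \<open>ues\<close> is already
    sorted by \<open>T\<close>.\<close>
  ultimately have kept: "filter (\<lambda>ue. ue \<in> set ues) us = ues"
    by (simp add: us_def filter_sort)
  obtain upos where upos: "\<And>k. k < length us \<Longrightarrow> upos (us ! k) = k"
    "\<And>ue. ue \<in> U \<Longrightarrow> upos ue < card U \<and> us ! upos ue = ue"
    using distinct_position[OF us(1)] us(2) length_us by metis
  have "\<forall>ue \<in> U. \<exists>a. 1 \<le> a \<and> a \<le> int (card (labs ue)) \<and>
      (ue \<in> set ues \<longrightarrow> fst (llist E ue ! (nat a - 1)) = lab (ev ue))"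
  proof
    fix ue assume ue: "ue \<in> U"
    show "\<exists>a. 1 \<le> a \<and> a \<le> int (card (labs ue)) \<and>
      (ue \<in> set ues \<longrightarrow> fst (llist E ue ! (nat a - 1)) = lab (ev ue))"
    proof (cases "ue \<in> set ues")
      case True
      then obtain p where "(lab (ev ue), p) \<in> labs ue" using ev(3) by blast
      then obtain k where "k < card (labs ue)" "llist E ue ! k = (lab (ev ue), p)"
        using llist[OF ue] by (metis in_set_conv_nth)
      \<comment> \<open>Label entries are numbered from 1; a dropped event may take the first one,
        as label sets are nonempty.\<close>
      then show ?thesis by (intro exI[of _ "int (Suc k)"]) (auto simp del: of_nat_Suc)
    next
      case False
      have "card (labs ue) \<noteq> 0" using uevent[OF ue] by (auto simp: is_uevent_def)
      then show ?thesis using False by (intro exI[of _ 1]) auto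
    qed
  qed
  then obtain A where A: "\<And>ue. ue \<in> U \<Longrightarrow> 1 \<le> A ue \<and> A ue \<le> int (card (labs ue)) \<and>
      (ue \<in> set ues \<longrightarrow> fst (llist E ue ! (nat (A ue) - 1)) = lab (ev ue))"
    by metis
  \<comment> \<open>A kept event forces its own value, a dropped one takes any admissible value of
    the right type, and outside \<open>U\<close> there is no condition, so the choice is
    total.\<close>
  have D_exists: "\<exists>x. ue \<in> U \<longrightarrow> (\<forall>S. uvals ue v = Some S \<longrightarrow> x \<in> S) \<and>
      (v \<in> pvars N \<longrightarrow> x \<in> domain_of (vty N v)) \<and>
      (ue \<in> set ues \<and> v \<in> pvars N \<longrightarrow> x = vals (ev ue) v)" for v ue
  proof (cases "ue \<in> set ues")
    case True
    then show ?thesis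
      using ev(1,4)[OF True] by (intro exI[of _ "vals (ev ue) v"]) (auto simp: events_def assigns_def)
  next
    case False
    show ?thesis
    proof (cases "uvals ue v")
      case None
      then show ?thesis using False domain_of_nonempty[of "vty N v"] by auto
    next
      case (Some S)
      show ?thesis
      proof (cases "ue \<in> U")
        case True
        then obtain x where "x \<in> S" "x \<in> domain_of (vty N v)"
          using uvals_admissible[OF True Some] by blast
        then show ?thesis using Some False by (intro exI[of _ x]) auto
      qed simp
    qed
  qed
  define D where "D v ue = (SOME x. ue \<in> U \<longrightarrow> (\<forall>S. uvals ue v = Some S \<longrightarrow> x \<in> S) \<and>
      (v \<in> pvars N \<longrightarrow> x \<in> domain_of (vty N v)) \<and>
      (ue \<in> set ues \<and> v \<in> pvars N \<longrightarrow> x = vals (ev ue) v))" for v ue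
  have D: "(\<forall>S. uvals ue v = Some S \<longrightarrow> D v ue \<in> S) \<and>
      (v \<in> pvars N \<longrightarrow> D v ue \<in> domain_of (vty N v)) \<and>
      (ue \<in> set ues \<and> v \<in> pvars N \<longrightarrow> D v ue = vals (ev ue) v)" if "ue \<in> U" for v ue
    using someI_ex[OF D_exists[of ue v]] that unfolding D_def by blast
  \<comment> \<open>\<open>P\<close> is the position in \<open>us\<close> counted from 1, and
    \<open>L\<close> reads identifiers off the same list; hence they are inverse to each
    other.\<close>
  define dr where "dr ue \<longleftrightarrow> ue \<notin> set ues" for ue
  define P where "P ue = int (Suc (upos ue))" for ue
  define L where "L i = uid (us ! (i - 1))" for i
  have "phi_trace E \<nu> \<and>
    (\<forall>v \<in> pvars N. \<forall>ue \<in> U. vD \<nu> v ue \<in> domain_of (vty N v)) \<and>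
    map (dec_event N E \<nu>) (filter (\<lambda>i. \<not> vdrop \<nu> (dec_uevent E \<nu> i)) [1..<Suc (card U)]) = es"
    if \<nu>: "vdrop \<nu> = dr \<and> vA \<nu> = A \<and> vT \<nu> = (\<lambda>ue. int (T ue)) \<and> vP \<nu> = P \<and> vD \<nu> = D \<and> vL \<nu> = L"
    for \<nu> :: "('id, 'p, 'a, 'v) enc"
  proof -
    have idx: "us ! (i - 1) \<in> U" "upos (us ! (i - 1)) = i - 1" if "i \<in> {1..card U}" for i
      using that us(2) length_us upos(1) nth_mem[of "i - 1" us] by auto
    have dec: "dec_uevent E \<nu> i = us ! (i - 1)" if "i \<in> {1..card U}" for i
      unfolding dec_uevent_def set_ulist using \<nu> idx(1)[OF that] uid_inject
      by (intro the_equality) (auto simp: L_def)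
    have dec_ev: "dec_event N E \<nu> i = ev (us ! (i - 1))"
      if i: "i \<in> {1..card U}" and "us ! (i - 1) \<in> set ues" for i
    proof -
      have "vals (ev (us ! (i - 1))) \<in> extensional (pvars N)"
        using ev(1)[OF that(2)] by (auto simp: events_def assigns_def PiE_iff)
      then have "(\<lambda>v \<in> pvars N. D v (us ! (i - 1))) = vals (ev (us ! (i - 1)))"
        using D[OF idx(1)[OF i]] that(2) by (intro extensionalityI[of _ "pvars N"]) auto
      then show ?thesis
        using A[OF idx(1)[OF i]] ev(2)[OF that(2)] that(2) \<nu>
        by (intro event.equality) (simp_all add: dec_event_def dec_entry_def Let_def dec[OF i])
    qed
    have "map (\<lambda>i. us ! (i - 1)) [1..<Suc (card U)] = us"
      by (rule nth_equalityI) (simp_all add: length_us del: upt_Suc)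
    then have "ues = filter (\<lambda>ue. ue \<in> set ues) (map (\<lambda>i. us ! (i - 1)) [1..<Suc (card U)])"
      using kept by simp
    also have "\<dots> = map (\<lambda>i. us ! (i - 1)) (filter (\<lambda>i. us ! (i - 1) \<in> set ues) [1..<Suc (card U)])"
      by (simp add: filter_map comp_def del: upt_Suc)
    finally have "es = map ev (map (\<lambda>i. us ! (i - 1))
        (filter (\<lambda>i. us ! (i - 1) \<in> set ues) [1..<Suc (card U)]))"
      using map_ev by simp
    also have "\<dots> = map (dec_event N E \<nu>) (filter (\<lambda>i. us ! (i - 1) \<in> set ues) [1..<Suc (card U)])"
      unfolding map_map by (rule map_cong) (auto simp: dec_ev simp del: upt_Suc)
    also have "filter (\<lambda>i. us ! (i - 1) \<in> set ues) [1..<Suc (card U)] =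
        filter (\<lambda>i. \<not> vdrop \<nu> (dec_uevent E \<nu> i)) [1..<Suc (card U)]"
      using \<nu> by (intro filter_cong) (auto simp: dec dr_def simp del: upt_Suc)
    finally have "map (dec_event N E \<nu>)
        (filter (\<lambda>i. \<not> vdrop \<nu> (dec_uevent E \<nu> i)) [1..<Suc (card U)]) = es" by simp
    moreover have "phi_trace E \<nu>"
    proof -
      \<comment> \<open>A realization contains every event of confidence 1.\<close>
      have "conf ue < 1" if "ue \<in> U" "dr ue" for ue
        using certain uevent[OF that(1)] that by (force simp: dr_def is_uevent_def)
      then have 1: "(dr ue \<longrightarrow> conf ue < 1) \<and> 1 \<le> A ue \<and> A ue \<le> int (card (labs ue)) \<and>
           (\<forall>v S. uvals ue v = Some S \<longrightarrow> D v ue \<in> S) \<and> int (T ue) \<in> int ` stamps ue"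
        if "ue \<in> U" for ue
        using that A D T by blast
      have 2: "L j \<in> uid ` U" if "j \<in> {1..card U}" for j
        using idx[OF that] by (simp add: L_def)
      have mono: "T x \<le> T y" if "x \<in> U" "y \<in> U" "P x \<le> P y" for x y
        using sorted_nth_mono[OF us(3), of "upos x" "upos y"] upos(2)[of x] upos(2)[of y] that length_us
        by (simp add: P_def)
      \<comment> \<open>The second implication is the contrapositive of monotonicity with
        \<open>x\<close> and \<open>y\<close> exchanged.\<close>
      have 3: "(P x < P y \<longrightarrow> int (T x) \<le> int (T y)) \<and> (int (T x) < int (T y) \<longrightarrow> P x < P y)"
        if "x \<in> U" "y \<in> U" for x y
        using mono[OF that] mono[OF that(2,1)] by force
      have 4: "L i = uid y \<longleftrightarrow> P y = int i" if "i \<in> {1..card U}" "y \<in> U" for i y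
      proof -
        have "L i = uid y \<longleftrightarrow> us ! (i - 1) = y"
          using uid_inject[OF idx(1)[OF that(1)] that(2)] by (auto simp: L_def)
        also have "\<dots> \<longleftrightarrow> upos y = i - 1"
          using idx[OF that(1)] upos(2)[OF that(2)] by auto
        finally show ?thesis using that(1) by (auto simp: P_def)
      qed
      have ul: "ulist E ! (i - 1) \<in> U" if "i \<in> {1..card U}" for i
        using that set_ulist length_ulist nth_mem[of "i - 1" "ulist E"] by auto
      have \<nu>': "vdrop \<nu> = dr" "vA \<nu> = A" "vT \<nu> = (\<lambda>ue. int (T ue))" "vP \<nu> = P" "vD \<nu> = D" "vL \<nu> = L"
        using \<nu> by auto
      show ?thesis
        unfolding phi_trace_def Let_def length_ulist set_ulist \<nu>'
        using 1 2 3[OF ul ul] 4[OF _ ul] by blast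
    qed
    ultimately show ?thesis using D \<nu> by auto
  qed
  then show ?thesis by blast
qed

text \<open>Once run and trace are encoded, distances can be added, and \<open>\<gamma>\<close>
  becomes one of the competitors to which the lower bound on \<open>d\<close> applies.\<close>

lemma alignment_encodable:
  assumes real: "realization N U (projL \<gamma>)" and run: "projM \<gamma> \<in> runs N"
  shows "\<exists>\<nu> :: ('id, 'p, 'a, 'v) enc. feasible N E C (length (projM \<gamma>)) \<nu> \<and>
    ereal (vd \<nu> (card U) (length (projM \<gamma>))) \<le> total_cost C U \<gamma>"
proof -
  obtain \<alpha>F where "steps N (init_marking N, init_assign N) (projM \<gamma>) (final_marking N, \<alpha>F)"
    using run by (auto simp: runs_def)
  from run_encodable[OF this] obtain S M X where
    R: "\<And>\<nu> :: ('id, 'p, 'a, 'v) enc. vS \<nu> = S \<and> vM \<nu> = M \<and> vX \<nu> = X \<Longrightarrow>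
      phi_run N E (length (projM \<gamma>)) \<nu> \<and>
      (\<forall>v \<in> pvars N. \<forall>i \<le> length (projM \<gamma>). vX \<nu> i v \<in> domain_of (vty N v)) \<and>
      map (dec_firing N E \<nu>) [1..<Suc (length (projM \<gamma>))] = projM \<gamma>"
    by metis
  from trace_encodable[OF real] obtain dr A T P D L where
    Tr: "\<And>\<nu> :: ('id, 'p, 'a, 'v) enc.
      vdrop \<nu> = dr \<and> vA \<nu> = A \<and> vT \<nu> = T \<and> vP \<nu> = P \<and> vD \<nu> = D \<and> vL \<nu> = L \<Longrightarrow>
      phi_trace E \<nu> \<and>
      (\<forall>v \<in> pvars N. \<forall>ue \<in> U. vD \<nu> v ue \<in> domain_of (vty N v)) \<and>
      map (dec_event N E \<nu>) (filter (\<lambda>i. \<not> vdrop \<nu> (dec_uevent E \<nu> i)) [1..<Suc (card U)]) = projL \<gamma>"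
    by metis
  define \<nu>0 :: "(nat \<Rightarrow> nat \<Rightarrow> real) \<Rightarrow> ('id, 'p, 'a, 'v) enc" where
    "\<nu>0 g = \<lparr>vS = S, vM = M, vX = X, vdrop = dr, vA = A, vT = T, vP = P, vD = D, vL = L, vd = g\<rparr>" for g
  have R0: "phi_run N E (length (projM \<gamma>)) (\<nu>0 g) \<and>
      (\<forall>v \<in> pvars N. \<forall>i \<le> length (projM \<gamma>). vX (\<nu>0 g) i v \<in> domain_of (vty N v)) \<and>
      map (dec_firing N E (\<nu>0 g)) [1..<Suc (length (projM \<gamma>))] = projM \<gamma>" for g
    by (rule R) (simp add: \<nu>0_def)
  have T0: "phi_trace E (\<nu>0 g) \<and>
      (\<forall>v \<in> pvars N. \<forall>ue \<in> U. vD (\<nu>0 g) v ue \<in> domain_of (vty N v)) \<and>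
      map (dec_event N E (\<nu>0 g))
        (filter (\<lambda>i. \<not> vdrop (\<nu>0 g) (dec_uevent E (\<nu>0 g) i)) [1..<Suc (card U)]) = projL \<gamma>" for g
    by (rule Tr) (simp add: \<nu>0_def)
  have decoded: "decoded N U C E (length (projM \<gamma>)) (\<nu>0 g)" for g
    using R0[of g] T0[of g] by unfold_locales (auto simp: enc_typed_def set_ulist)
  \<comment> \<open>The initial \<open>undefined\<close> is a placeholder for the distances and is
    overwritten by \<open>g\<close>.\<close>
  obtain g where g: "phi_delta N E C (length (projM \<gamma>)) (\<nu>0 g)"
    using decoded.phi_delta_exists[OF decoded[of undefined]] by (auto simp: \<nu>0_def)
  interpret weighted N U C E "length (projM \<gamma>)" "\<nu>0 g"
    using decoded[of g] g by (simp add: weighted_def weighted_axioms_def)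
  have "feasible N E C (length (projM \<gamma>)) (\<nu>0 g)"
    using typed run ordered g by (simp add: feasible_def)
  moreover have "ereal (vd (\<nu>0 g) (card U) (length (projM \<gamma>))) \<le> total_cost C U \<gamma>"
    by (rule total_cost_lower_bound) (use R0 T0 in \<open>simp_all add: events_upto_def firings_upto_def del: upt_Suc\<close>)
  ultimately show ?thesis by blast
qed

text \<open>The encoding describes runs of length exactly \<open>n\<close>. Silent firings at the
  final marking fill the gap; they are free and do not touch the log projection.\<close>

lemma pad_run:
  assumes fs: "projM \<gamma> \<in> runs N" "length (projM \<gamma>) \<le> n"
    and loop: "t \<in> transitions N" "silent N t"
      "\<And>\<alpha>. \<alpha> \<in> assigns N \<Longrightarrow> \<exists>\<beta>. step N (final_marking N, \<alpha>) (t, \<beta>) (final_marking N, \<alpha>)"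
  shows "\<exists>\<gamma>'. projL \<gamma>' = projL \<gamma> \<and> projM \<gamma>' \<in> runs N \<and> length (projM \<gamma>') = n \<and>
    total_cost C U \<gamma>' = total_cost C U \<gamma>"
proof -
  obtain \<alpha>F where \<alpha>F: "steps N (init_marking N, init_assign N) (projM \<gamma>) (final_marking N, \<alpha>F)"
    using fs by (auto simp: runs_def)
  \<comment> \<open>The loop is available only at well-typed assignments; the empty run inherits
    this from the initial one.\<close>
  then have "\<alpha>F \<in> assigns N" using steps_assigns dpn by (fastforce simp: is_dpn_def)
  then obtain \<beta> where \<beta>: "step N (final_marking N, \<alpha>F) (t, \<beta>) (final_marking N, \<alpha>F)"
    using loop by blast
  let ?r = "replicate (n - length (projM \<gamma>)) (t, \<beta>)"
  let ?\<gamma> = "\<gamma> @ map (\<lambda>f. (None, Some f)) ?r"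
  have run: "steps N (init_marking N, init_assign N) (projM ?\<gamma>) (final_marking N, \<alpha>F)"
    using \<alpha>F steps_replicate_loop[OF \<beta>] by (auto simp: steps_append simp del: map_replicate)
  have "sum_list (replicate k (0 :: ereal)) = 0" for k
    by (induction k) auto
  moreover have "PM C (t, \<beta>) = 0"
    using penalty step_firings[OF \<beta>] loop by (auto simp: is_penalty_def)
  ultimately have "alignment_cost C U (map (\<lambda>f. (None, Some f)) ?r) = 0"
    by (simp add: alignment_cost_def comp_def map_replicate_const flip: zero_ereal_def)
  then show ?thesis
    using fs run by (intro exI[of _ ?\<gamma>]) (auto simp: runs_def total_cost_def simp del: map_replicate)
qed

end

theorem theorem1:
  fixes N :: "('p, 't, 'a, 'v) dpn"
    and U :: "('id, 'a, 'v) uevent set"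
    and C :: "('id, 't, 'a, 'v) penalty"
    and E :: "('id, 't, 'a, 'v) enums"
    and n :: nat
    and \<nu> :: "('id, 'p, 'a, 'v) enc"
  assumes dpn: "is_dpn N" "runs N \<noteq> {}"
    and trace: "log_trace N U"
    and penalty: "is_penalty N C"
    and final_nonempty: "\<exists>p \<in> places N. final_marking N p > 0"
    and silent_loop: "\<exists>t \<in> transitions N. silent N t \<and>
      (\<forall>\<alpha> \<in> assigns N. \<exists>\<beta>. step N (final_marking N, \<alpha>) (t, \<beta>) (final_marking N, \<alpha>))"
    and enums: "is_enums N U E"
    and bound: "\<exists>\<gamma>. optimal N C U \<gamma> \<and> length (projM \<gamma>) \<le> n"
    and solution: "solution N E C n \<nu>"
  shows "optimal N C U (decode N E C \<nu> (card U) n) \<and>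
    total_cost C U (decode N E C \<nu> (card U) n) = ereal (vd \<nu> (card U) n)"
proof -
  interpret uncertain_trace N U C E
    using dpn(1) trace penalty enums by unfold_locales
  interpret weighted N U C E n \<nu>
    using solution by unfold_locales (simp_all add: solution_def feasible_def)
  obtain \<gamma> es where opt: "optimal N C U \<gamma>" and len: "length (projM \<gamma>) \<le> n"
    and es: "realization N U es" "alignment N es \<gamma>"
    using bound by (auto simp: optimal_def)
  obtain t where "t \<in> transitions N" "silent N t"
    "\<And>\<alpha>. \<alpha> \<in> assigns N \<Longrightarrow> \<exists>\<beta>. step N (final_marking N, \<alpha>) (t, \<beta>) (final_marking N, \<alpha>)"
    using silent_loop by blast
  then obtain \<gamma>' where \<gamma>': "projL \<gamma>' = es" "projM \<gamma>' \<in> runs N" "length (projM \<gamma>') = n"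
    "total_cost C U \<gamma>' = total_cost C U \<gamma>"
    using pad_run[of \<gamma> n t] es(2) len by (auto simp: alignment_def)
  obtain \<nu>' :: "('id, 'p, 'a, 'v) enc" where \<nu>': "feasible N E C n \<nu>'"
    "ereal (vd \<nu>' (card U) n) \<le> total_cost C U \<gamma>"
    using alignment_encodable[of \<gamma>'] \<gamma>' es(1) by auto
  \<comment> \<open>Minimality of the solution against the assignment built from the padded optimal
    alignment.\<close>
  have "vd \<nu> (card U) n \<le> vd \<nu>' (card U) n"
    using solution \<nu>'(1) length_ulist by (auto simp: solution_def)
  then have le: "ereal (vd \<nu> (card U) n) \<le> total_cost C U \<gamma>"
    using \<nu>'(2) by (meson ereal_less_eq(3) order_trans)
  \<comment> \<open>An alignment cheaper than the decoded one would also be cheaper than the optimal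
    \<open>\<gamma>\<close>.\<close>
  then have "optimal N C U (decode N E C \<nu> (card U) n)"
    using opt events_upto_realization decode_alignment unfolding optimal_def
    by (metis less_le_trans not_le)
  then show ?thesis using decode_alignment(2) by blast
qed

end
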